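(* Let $\mathbf{d}$ and $\mathbf{e}$ be distances on a set $X$. Then $X$ is $\mathbf{d}$-complete if any one of the following conditions holds. (1) $X$ is $\leq^{\mathbf{d}}$-$\mathbf{d}$-complete and $\mathbf{d}^\bullet\precapprox\mathbf{I}$. (2) $X$ is $\leq^{\mathbf{d}}$-$\mathbf{d}$-complete, $X$ is $\mathbf{d}^\vee$-complete, and $\mathbf{d}_{\mathbf{F}}\leq\mathbf{I}$. (3) $X$ is $\mathbf{d}$-$\mathbf{d}$-complete, $X$ is $\mathbf{e}$-complete, and $\mathbf{e}\circ\Phi^{\mathbf{d}}\precapprox\mathbf{d}\precapprox\mathbf{e}=\mathbf{e}^{\mathrm{op}}$. (4) $X$ is $\leq^{\mathbf{d}}$-$\mathbf{d}$-complete, $X$ is $\mathbf{e}$-complete, $X$ is $\mathbf{e}$-separable, and $\mathbf{e}\circ\Phi^{\mathbf{d}}\precapprox\mathbf{d}\precapprox\mathbf{e}=\mathbf{e}^{\mathrm{op}}$.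
   Context: A distance on $X$ is a function $\mathbf{d}:X\times X\to[0,\infty]$ with $\mathbf{d}(x,y)\leq\mathbf{d}(x,z)+\mathbf{d}(z,y)$ for all $x,y,z\in X$ (neither symmetry nor $\mathbf{d}(x,x)=0$ is required). In $[0,\infty]$, $\inf\emptyset=\infty$ and $\sup\emptyset=0$. Nets: a net is a family $(x_\lambda)_{\lambda\in\Lambda}$ indexed by a nonempty set $\Lambda$ with a transitive (possibly non-reflexive) relation $\prec$ such that for all $\gamma,\delta\in\Lambda$ there is $\lambda$ with $\gamma,\delta\prec\lambda$. Limits are taken with "eventually" meaning "for all $\lambda\succ\alpha$, for some $\alpha$". The net is $\mathbf{d}$-Cauchy if for every $\epsilon>0$ there is $\alpha$ such that $\mathbf{d}(x_\gamma,x_\delta)<\epsilon$ whenever $\alpha\prec\gamma\prec\delta$. $\mathbf{d}$-completeness: $X^\circ_\circ$ denotes the topology on $X$ generated by all sets $\{x:\mathbf{d}(x,c)>\epsilon\}$ and $\{x:\mathbf{d}(c,x)>\epsilon\}$ ($c\in X$, $\epsilon\ge 0$); equivalently $x_\lambda\to x$ in $X^\circ_\circ$ iff $\liminf_\lambda\mathbf{d}(x_\lambda,c)\geq\mathbf{d}(x,c)$ and $\liminf_\lambda\mathbf{d}(c,x_\lambda)\geq\mathbf{d}(c,x)$ for all $c\in X$. $X$ is $\mathbf{d}$-complete if every $\mathbf{d}$-Cauchy net in $X$ has a limit in $X^\circ_\circ$. For another distance ($\mathbf{e}$, $\mathbf{d}^\vee$), completeness is defined in the same way with that distance in place of $\mathbf{d}$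 throughout (including in the topology). Order: $x\leq^{\mathbf{d}}y$ iff $\mathbf{d}(x,y)=0$. For $Y\subseteq X$, $Y\leq^{\mathbf{d}}x$ means $y\leq^{\mathbf{d}}x$ for all $y\in Y$, and $y\leq^{\mathbf{d}}Y$ means $y\leq^{\mathbf{d}}z$ for all $z\in Y$. An element $x\in X$ is a $\mathbf{d}$-supremum of $Y$ if $Y\leq^{\mathbf{d}}x$ and $\mathbf{d}(x,z)=\sup_{y\in Y}\mathbf{d}(y,z)$ for all $z\in X$. $Y$ is $\mathbf{d}$-directed if for every finite $F\subseteq Y$, $\inf_{y\in Y}\sup_{z\in F}\mathbf{d}(z,y)=0$; $Y$ is $\leq^{\mathbf{d}}$-directed if every finite $F\subseteq Y$ has some $y\in Y$ with $F\leq^{\mathbf{d}}y$. $X$ is $\mathbf{d}$-$\mathbf{d}$-complete (resp. $\leq^{\mathbf{d}}$-$\mathbf{d}$-complete) if every $\mathbf{d}$-directed (resp. $\leq^{\mathbf{d}}$-directed) $Y\subseteq X$ has a $\mathbf{d}$-supremum. Auxiliary functions: $\mathbf{I}$ is the identity on $[0,\infty]$. With $x^\bullet_r=\{z:\mathbf{d}(x,z)<r\}$ and $x_\bullet^r=\{z:\mathbf{d}(z,x)<r\}$, define for $r\in[0,\infty]$ $$\mathbf{d}^\bullet(r)=\sup_{x\in X}\ \inf_{y\leq^{\mathbf{d}}x^\bullet_r}\mathbf{d}(x,y),\qquad \mathbf{d}_{\mathbf{F}}(r)=\sup_{x\in X}\ \sup_{F\subseteq x_\bullet^r,\ F\text{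 finite}}\ \inf_{F\leq^{\mathbf{d}}y}\mathbf{d}(y,x).$$ $\mathbf{d}^{\mathrm{op}}(x,y)=\mathbf{d}(y,x)$ and $\mathbf{d}^\vee(x,y)=\max(\mathbf{d}(x,y),\mathbf{d}(y,x))$. Also $$(\mathbf{e}\circ\Phi^{\mathbf{d}})(x,y)=\sup_{\epsilon>0}\ \inf\{\mathbf{e}(x,z):z\in X,\ \mathbf{d}(z,y)<\epsilon\}.$$ For $[0,\infty]$-valued functions $f,g$ on a common set $S$, $f\precapprox g$ means $\sup\{f(s):s\in S,\ g(s)\leq r\}\to0$ as $r\to0$ (so $\mathbf{d}^\bullet\precapprox\mathbf{I}$ means $\lim_{r\to0}\mathbf{d}^\bullet(r)=0$). $X$ is $\mathbf{e}$-separable if there is a countable $Y\subseteq X$ with $\inf_{y\in Y}\mathbf{e}(x,y)=0$ for all $x\in X$. *)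

theory Defs
  imports "HOL-Analysis.Analysis"
begin

text \<open>The space is a carrier set \<open>X\<close> (possibly empty), and a distance is a function
  \<open>d :: 'a \<Rightarrow> 'a \<Rightarrow> ennreal\<close> that is only constrained, and only inspected, on \<open>X\<close>.
  In \<^typ>\<open>ennreal\<close>, \<open>Inf {} = top\<close> and \<open>Sup {} = 0\<close>.\<close>

definition distance_on :: "'a set \<Rightarrow> ('a \<Rightarrow> 'a \<Rightarrow> ennreal) \<Rightarrow> bool" where
  "distance_on X d \<longleftrightarrow> (\<forall>x\<in>X. \<forall>y\<in>X. \<forall>z\<in>X. d x y \<le> d x z + d z y)"

definition dist_op :: "('a \<Rightarrow> 'a \<Rightarrow> ennreal) \<Rightarrow> 'a \<Rightarrow> 'a \<Rightarrow> ennreal" where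
  "dist_op d x y = d y x"

definition dist_sym :: "('a \<Rightarrow> 'a \<Rightarrow> ennreal) \<Rightarrow> 'a \<Rightarrow> 'a \<Rightarrow> ennreal" where
  "dist_sym d x y = max (d x y) (d y x)"

definition dist_le :: "('a \<Rightarrow> 'a \<Rightarrow> ennreal) \<Rightarrow> 'a \<Rightarrow> 'a \<Rightarrow> bool" where
  "dist_le d x y \<longleftrightarrow> d x y = 0"


subsection \<open>Nets and completeness\<close>

definition net_index :: "'i set \<Rightarrow> ('i \<Rightarrow> 'i \<Rightarrow> bool) \<Rightarrow> bool" where
  "net_index \<Lambda> R \<longleftrightarrow> \<Lambda> \<noteq> {} \<and> transp_on \<Lambda> R \<and>
     (\<forall>\<gamma>\<in>\<Lambda>. \<forall>\<delta>\<in>\<Lambda>. \<exists>\<kappa>\<in>\<Lambda>. R \<gamma> \<kappa> \<and> R \<delta> \<kappa>)"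

definition net_filter :: "'i set \<Rightarrow> ('i \<Rightarrow> 'i \<Rightarrow> bool) \<Rightarrow> 'i filter" where
  "net_filter \<Lambda> R = (INF \<alpha>\<in>\<Lambda>. principal {\<kappa>\<in>\<Lambda>. R \<alpha> \<kappa>})"

lemma eventually_net_filter:
  assumes "net_index \<Lambda> R"
  shows "eventually P (net_filter \<Lambda> R) \<longleftrightarrow> (\<exists>\<alpha>\<in>\<Lambda>. \<forall>\<kappa>\<in>\<Lambda>. R \<alpha> \<kappa> \<longrightarrow> P \<kappa>)"
proof -
  have "\<exists>x\<in>\<Lambda>. principal {\<kappa>\<in>\<Lambda>. R x \<kappa>} \<le> inf (principal {\<kappa>\<in>\<Lambda>. R a \<kappa>}) (principal {\<kappa>\<in>\<Lambda>. R b \<kappa>})"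
    if ab: "a \<in> \<Lambda>" "b \<in> \<Lambda>" for a b
  proof -
    from assms ab obtain c where c: "c \<in> \<Lambda>" "R a c" "R b c"
      unfolding net_index_def by blast
    have "R a l \<and> R b l" if "l \<in> \<Lambda>" "R c l" for l
      using assms ab c that unfolding net_index_def by (blast dest: transp_onD)
    with c(1) show ?thesis by auto
  qed
  moreover have "\<Lambda> \<noteq> {}" using assms unfolding net_index_def by blast
  ultimately show ?thesis
    unfolding net_filter_def
    by (subst eventually_INF_base) (auto simp: eventually_principal)
qed

definition net_cauchy ::
  "('a \<Rightarrow> 'a \<Rightarrow> ennreal) \<Rightarrow> 'i set \<Rightarrow> ('i \<Rightarrow> 'i \<Rightarrow> bool) \<Rightarrow> ('i \<Rightarrow> 'a) \<Rightarrow> bool" where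
  "net_cauchy d \<Lambda> R x \<longleftrightarrow>
     (\<forall>\<epsilon>>0. \<exists>\<alpha>\<in>\<Lambda>. \<forall>\<gamma>\<in>\<Lambda>. \<forall>\<delta>\<in>\<Lambda>. R \<alpha> \<gamma> \<and> R \<gamma> \<delta> \<longrightarrow> d (x \<gamma>) (x \<delta>) < \<epsilon>)"

text \<open>\<open>X\<close> itself is added to the generators because a point at distance \<open>0\<close> to and from
  every point of \<open>X\<close> lies in no other generator.\<close>

definition hole_topology :: "'a set \<Rightarrow> ('a \<Rightarrow> 'a \<Rightarrow> ennreal) \<Rightarrow> 'a topology" where
  "hole_topology X d = topology_generated_by
     (insert X ({{x\<in>X. d x c > \<epsilon>} |c \<epsilon>. c \<in> X} \<union> {{x\<in>X. d c x > \<epsilon>} |c \<epsilon>. c \<in> X}))"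

text \<open>Completeness with respect to all nets whose index set is a subset of the type \<open>'i\<close>.
  The limit lies in \<open>X\<close>, the topspace. For distances on \<open>X :: 'a set\<close>, completeness for the
  index type \<open>('a \<times> nat) set\<close> implies completeness for every index type, see
  \<open>dist_complete_any_index\<close> below.\<close>

definition dist_complete :: "'i itself \<Rightarrow> 'a set \<Rightarrow> ('a \<Rightarrow> 'a \<Rightarrow> ennreal) \<Rightarrow> bool" where
  "dist_complete (_ :: 'i itself) X d \<longleftrightarrow>
     (\<forall>(\<Lambda> :: 'i set) R x. net_index \<Lambda> R \<and> (\<forall>\<kappa>\<in>\<Lambda>. x \<kappa> \<in> X) \<and> net_cauchy d \<Lambda> R x \<longrightarrow>
        (\<exists>l. limitin (hole_topology X d) x l (net_filter \<Lambda> R)))"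


subsection \<open>Directed subsets and suprema\<close>

definition dist_supremum :: "'a set \<Rightarrow> ('a \<Rightarrow> 'a \<Rightarrow> ennreal) \<Rightarrow> 'a set \<Rightarrow> 'a \<Rightarrow> bool" where
  "dist_supremum X d Y x \<longleftrightarrow>
     x \<in> X \<and> (\<forall>y\<in>Y. dist_le d y x) \<and> (\<forall>z\<in>X. d x z = (SUP y\<in>Y. d y z))"

definition dist_directed :: "('a \<Rightarrow> 'a \<Rightarrow> ennreal) \<Rightarrow> 'a set \<Rightarrow> bool" where
  "dist_directed d Y \<longleftrightarrow> (\<forall>F. finite F \<and> F \<subseteq> Y \<longrightarrow> (INF y\<in>Y. SUP z\<in>F. d z y) = 0)"

definition dist_le_directed :: "('a \<Rightarrow> 'a \<Rightarrow> ennreal) \<Rightarrow> 'a set \<Rightarrow> bool" where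
  "dist_le_directed d Y \<longleftrightarrow> (\<forall>F. finite F \<and> F \<subseteq> Y \<longrightarrow> (\<exists>y\<in>Y. \<forall>z\<in>F. dist_le d z y))"

definition dist_directed_complete :: "'a set \<Rightarrow> ('a \<Rightarrow> 'a \<Rightarrow> ennreal) \<Rightarrow> bool" where
  "dist_directed_complete X d \<longleftrightarrow>
     (\<forall>Y. Y \<subseteq> X \<and> dist_directed d Y \<longrightarrow> (\<exists>x. dist_supremum X d Y x))"

definition dist_le_directed_complete :: "'a set \<Rightarrow> ('a \<Rightarrow> 'a \<Rightarrow> ennreal) \<Rightarrow> bool" where
  "dist_le_directed_complete X d \<longleftrightarrow>
     (\<forall>Y. Y \<subseteq> X \<and> dist_le_directed d Y \<longrightarrow> (\<exists>x. dist_supremum X d Y x))"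


subsection \<open>Auxiliary functions, comparison and separability\<close>

definition upper_ball :: "'a set \<Rightarrow> ('a \<Rightarrow> 'a \<Rightarrow> ennreal) \<Rightarrow> 'a \<Rightarrow> ennreal \<Rightarrow> 'a set" where
  "upper_ball X d x r = {z\<in>X. d x z < r}"

definition lower_ball :: "'a set \<Rightarrow> ('a \<Rightarrow> 'a \<Rightarrow> ennreal) \<Rightarrow> 'a \<Rightarrow> ennreal \<Rightarrow> 'a set" where
  "lower_ball X d x r = {z\<in>X. d z x < r}"

definition d_bullet :: "'a set \<Rightarrow> ('a \<Rightarrow> 'a \<Rightarrow> ennreal) \<Rightarrow> ennreal \<Rightarrow> ennreal" where
  "d_bullet X d r =
     (SUP x\<in>X. INF y\<in>{y\<in>X. \<forall>z\<in>upper_ball X d x r. dist_le d y z}. d x y)"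

definition d_fin :: "'a set \<Rightarrow> ('a \<Rightarrow> 'a \<Rightarrow> ennreal) \<Rightarrow> ennreal \<Rightarrow> ennreal" where
  "d_fin X d r =
     (SUP x\<in>X. SUP F\<in>{F. finite F \<and> F \<subseteq> lower_ball X d x r}.
        INF y\<in>{y\<in>X. \<forall>z\<in>F. dist_le d z y}. d y x)"

definition comp_Phi ::
  "'a set \<Rightarrow> ('a \<Rightarrow> 'a \<Rightarrow> ennreal) \<Rightarrow> ('a \<Rightarrow> 'a \<Rightarrow> ennreal) \<Rightarrow> 'a \<Rightarrow> 'a \<Rightarrow> ennreal" where
  "comp_Phi X e d x y = (SUP \<epsilon>\<in>{0<..}. INF z\<in>{z\<in>X. d z y < \<epsilon>}. e x z)"

definition precapprox :: "'s set \<Rightarrow> ('s \<Rightarrow> ennreal) \<Rightarrow> ('s \<Rightarrow> ennreal) \<Rightarrow> bool" where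
  "precapprox S f g \<longleftrightarrow>
     ((\<lambda>r::ennreal. SUP s\<in>{s\<in>S. g s \<le> r}. f s) \<longlongrightarrow> 0) (at_right 0)"

abbreviation dist_precapprox ::
  "'a set \<Rightarrow> ('a \<Rightarrow> 'a \<Rightarrow> ennreal) \<Rightarrow> ('a \<Rightarrow> 'a \<Rightarrow> ennreal) \<Rightarrow> bool" where
  "dist_precapprox X d e \<equiv> precapprox (X \<times> X) (\<lambda>(x, y). d x y) (\<lambda>(x, y). e x y)"

definition dist_separable :: "'a set \<Rightarrow> ('a \<Rightarrow> 'a \<Rightarrow> ennreal) \<Rightarrow> bool" where
  "dist_separable X e \<longleftrightarrow> (\<exists>Y\<subseteq>X. countable Y \<and> (\<forall>x\<in>X. (INF y\<in>Y. e x y) = 0))"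


subsection \<open>Independence of the index type\<close>

lemma topspace_hole_topology [simp]: "topspace (hole_topology X d) = X"
  unfolding hole_topology_def topology_generated_by_topspace by auto

lemma limitin_topology_generated_by:
  "limitin (topology_generated_by S) f l F \<longleftrightarrow>
     l \<in> \<Union>S \<and> (\<forall>U\<in>S. l \<in> U \<longrightarrow> eventually (\<lambda>i. f i \<in> U) F)"
proof (intro iffI conjI ballI impI)
  assume "limitin (topology_generated_by S) f l F"
  then show "l \<in> \<Union>S"
    by (simp add: limitin_def topology_generated_by_topspace)
next
  fix U assume "limitin (topology_generated_by S) f l F" "U \<in> S" "l \<in> U"
  then show "eventually (\<lambda>i. f i \<in> U) F"
    by (simp add: limitin_def topology_generated_by_Basis)
next
  assume r: "l \<in> \<Union>S \<and> (\<forall>U\<in>S. l \<in> U \<longrightarrow> eventually (\<lambda>i. f i \<in> U) F)"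
  have "l \<in> U \<longrightarrow> eventually (\<lambda>i. f i \<in> U) F" if "generate_topology_on S U" for U
    using that
  proof induction
    case (UN K)
    show ?case
    proof
      assume "l \<in> \<Union>K"
      then obtain k where "k \<in> K" "l \<in> k" by blast
      with UN.IH[of k] show "eventually (\<lambda>i. f i \<in> \<Union>K) F"
        by (auto elim!: eventually_mono)
    qed
  next
    case (Int a b)
    then show ?case by (simp add: eventually_conj_iff)
  next
    case (Basis s)
    with r show ?case by blast
  qed simp
  with r show "limitin (topology_generated_by S) f l F"
    by (simp add: limitin_def topology_generated_by_topspace openin_topology_generated_by_iff)
qed

lemma limitin_hole_topology:
  "limitin (hole_topology X d) f l F \<longleftrightarrow>
     l \<in> X \<and> eventually (\<lambda>i. f i \<in> X) F \<and>
     (\<forall>c\<in>X. \<forall>\<epsilon><d l c. eventually (\<lambda>i. f i \<in> X \<and> \<epsilon> < d (f i) c) F) \<and>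
     (\<forall>c\<in>X. \<forall>\<epsilon><d c l. eventually (\<lambda>i. f i \<in> X \<and> \<epsilon> < d c (f i)) F)"
proof -
  have *: "(\<forall>U\<in>{{x\<in>X. g x c > \<epsilon>} |c \<epsilon>. c \<in> X}. l \<in> U \<longrightarrow> eventually (\<lambda>i. f i \<in> U) F) \<longleftrightarrow>
      (\<forall>c\<in>X. \<forall>\<epsilon><g l c. eventually (\<lambda>i. f i \<in> X \<and> \<epsilon> < g (f i) c) F)"
    if "l \<in> X" for g :: "'a \<Rightarrow> 'a \<Rightarrow> ennreal"
  proof -
    have "(\<forall>U\<in>{{x\<in>X. g x c > \<epsilon>} |c \<epsilon>. c \<in> X}. Q U) \<longleftrightarrow> (\<forall>c\<in>X. \<forall>\<epsilon>. Q {x\<in>X. g x c > \<epsilon>})" for Q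
      by blast
    with that show ?thesis by simp
  qed
  have "l \<in> \<Union>(insert X ({{x\<in>X. d x c > \<epsilon>} |c \<epsilon>. c \<in> X} \<union> {{x\<in>X. d c x > \<epsilon>} |c \<epsilon>. c \<in> X})) \<longleftrightarrow> l \<in> X"
    by blast
  then show ?thesis
    unfolding hole_topology_def limitin_topology_generated_by ball_simps(7) ball_Un
    using *[of d] *[of "\<lambda>x c. d c x"] by argo
qed

lemma net_index_finite_bound:
  assumes "net_index \<Lambda> R" "finite A" "A \<subseteq> \<Lambda>"
  shows "\<exists>b\<in>\<Lambda>. \<forall>a\<in>A. R a b"
  using assms(2,3)
proof (induction A)
  case empty
  then show ?case using assms(1) unfolding net_index_def by blast
next
  case (insert a A)
  then obtain b where b: "b \<in> \<Lambda>" "\<forall>a\<in>A. R a b" by auto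
  with insert.prems assms(1) obtain c where c: "c \<in> \<Lambda>" "R a c" "R b c"
    unfolding net_index_def by (metis insert_subset)
  have "R a' c" if "a' \<in> A" for a'
    using assms(1) b c that insert.prems unfolding net_index_def
    by (meson insert_subset subsetD transp_onD)
  with c show ?case by blast
qed

lemma ennreal_inverse_nat_gap:
  fixes a b :: ennreal
  assumes "a < b"
  shows "\<exists>n. a + (1 / of_nat (Suc n) + 1 / of_nat (Suc n)) \<le> b"
proof -
  have "(\<lambda>n. a + (ennreal (1 / real (Suc n)) + ennreal (1 / real (Suc n)))) \<longlonglongrightarrow> a + (ennreal 0 + ennreal 0)"
    by (intro tendsto_intros tendsto_ennrealI LIMSEQ_Suc[OF lim_1_over_n])
  then have "eventually (\<lambda>n. a + (ennreal (1 / real (Suc n)) + ennreal (1 / real (Suc n))) < b) sequentially"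
    using assms by (auto simp: order_tendsto_iff)
  then obtain n where "a + (ennreal (1 / real (Suc n)) + ennreal (1 / real (Suc n))) < b"
    by (auto simp: eventually_sequentially)
  moreover have "ennreal (1 / real (Suc n)) = 1 / of_nat (Suc n)"
    by (simp add: divide_ennreal[symmetric] ennreal_of_nat_eq_real_of_nat del: of_nat_Suc)
  ultimately show ?thesis by (auto intro: less_imp_le)
qed

lemma dist_complete_any_index:
  fixes X :: "'a set"
  assumes d: "distance_on X d" and C: "dist_complete TYPE(('a \<times> nat) set) X d"
  shows "dist_complete TYPE('i) X d"
  unfolding dist_complete_def
proof (intro allI impI, elim conjE)
  fix \<Lambda> :: "'i set" and R and x :: "'i \<Rightarrow> 'a"
  assume N: "net_index \<Lambda> R" and xX: "\<forall>\<kappa>\<in>\<Lambda>. x \<kappa> \<in> X" and Cau: "net_cauchy d \<Lambda> R x"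
  define q :: "nat \<Rightarrow> ennreal" where "q n = 1 / of_nat (Suc n)" for n
  have q_pos: "0 < q n" for n
    unfolding q_def by (simp add: ennreal_zero_less_divide of_nat_less_top del: of_nat_Suc)
  have tr: "R a c" if "R a b" "R b c" "a \<in> \<Lambda>" "b \<in> \<Lambda>" "c \<in> \<Lambda>" for a b c
    using N that unfolding net_index_def by (meson transp_onD)
  have tri: "d u w \<le> d u v + d v w" if "u \<in> X" "v \<in> X" "w \<in> X" for u v w
    using d that unfolding distance_on_def by blast
  have "\<forall>n. \<exists>\<alpha>\<in>\<Lambda>. \<forall>\<gamma>\<in>\<Lambda>. \<forall>\<delta>\<in>\<Lambda>. R \<alpha> \<gamma> \<and> R \<gamma> \<delta> \<longrightarrow> d (x \<gamma>) (x \<delta>) < q n"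
    using Cau q_pos unfolding net_cauchy_def by blast
  then obtain \<alpha> where \<alpha>: "\<And>n. \<alpha> n \<in> \<Lambda>"
    and \<alpha>C: "\<And>n \<gamma> \<delta>. \<gamma> \<in> \<Lambda> \<Longrightarrow> \<delta> \<in> \<Lambda> \<Longrightarrow> R (\<alpha> n) \<gamma> \<Longrightarrow> R \<gamma> \<delta> \<Longrightarrow> d (x \<gamma>) (x \<delta>) < q n"
    by metis
  have "\<exists>b. b \<in> \<Lambda> \<and> R (\<alpha> n) b \<and> (\<forall>\<mu>\<in>\<Lambda>. R (\<alpha> n) \<mu> \<longrightarrow> d c (x b) \<le> d c (x \<mu>) + q n)" for c n
  proof -
    define I where "I = (INF \<mu>\<in>{\<mu>\<in>\<Lambda>. R (\<alpha> n) \<mu>}. d c (x \<mu>))"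
    obtain b0 where b0: "b0 \<in> \<Lambda>" "R (\<alpha> n) b0"
      using N \<alpha>[of n] unfolding net_index_def by blast
    have low: "I \<le> d c (x \<mu>)" if "\<mu> \<in> \<Lambda>" "R (\<alpha> n) \<mu>" for \<mu>
      unfolding I_def using that by (intro INF_lower) auto
    have "\<exists>b. b \<in> \<Lambda> \<and> R (\<alpha> n) b \<and> d c (x b) \<le> I + q n"
    proof (cases "I = top")
      case True
      then show ?thesis using b0 by auto
    next
      case False
      then have "I < I + q n"
        using q_pos[of n] by (metis add.right_neutral ennreal_add_left_cancel_less infinity_ennreal_def)
      then obtain b where "b \<in> \<Lambda>" "R (\<alpha> n) b" "d c (x b) < I + q n"
        unfolding I_def INF_less_iff by auto
      then show ?thesis by (auto intro: less_imp_le)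
    qed
    then show ?thesis
      using low by (meson add_right_mono order_trans)
  qed
  then have "\<forall>c n. \<exists>b. b \<in> \<Lambda> \<and> R (\<alpha> n) b \<and> (\<forall>\<mu>\<in>\<Lambda>. R (\<alpha> n) \<mu> \<longrightarrow> d c (x b) \<le> d c (x \<mu>) + q n)"
    by blast
  then obtain b where b': "\<forall>c n. b c n \<in> \<Lambda> \<and> R (\<alpha> n) (b c n) \<and>
      (\<forall>\<mu>\<in>\<Lambda>. R (\<alpha> n) \<mu> \<longrightarrow> d c (x (b c n)) \<le> d c (x \<mu>) + q n)"
    unfolding choice_iff by (elim exE)
  then have b: "b c n \<in> \<Lambda>" "R (\<alpha> n) (b c n)" for c n
    by blast+
  have bI: "d c (x (b c n)) \<le> d c (x \<mu>) + q n" if "\<mu> \<in> \<Lambda>" "R (\<alpha> n) \<mu>" for c n \<mu>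
    using b' that by blast
  define P :: "(('a \<times> nat) set \<Rightarrow> 'i) \<Rightarrow> ('a \<times> nat) set \<Rightarrow> 'i \<Rightarrow> bool" where
    "P f F r \<longleftrightarrow> (finite F \<longrightarrow> r \<in> \<Lambda> \<and> (\<forall>(c, n)\<in>F. R (b c n) r) \<and> (\<forall>G. G \<subset> F \<longrightarrow> R (f G) r))"
    for f F r
  have "\<exists>h. \<forall>F. P h F (h F)"
  proof (rule dependent_wf_choice[OF wf_finite_psubset])
    fix f g :: "('a \<times> nat) set \<Rightarrow> 'i" and F r
    assume "\<And>z. (z, F) \<in> finite_psubset \<Longrightarrow> f z = g z"
    then show "P f F r = P g F r" unfolding P_def by (auto simp: finite_psubset_def)
  next
    fix F and f :: "('a \<times> nat) set \<Rightarrow> 'i"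
    assume IH: "\<And>G. (G, F) \<in> finite_psubset \<Longrightarrow> P f G (f G)"
    show "\<exists>r. P f F r"
    proof (cases "finite F")
      case True
      have "f G \<in> \<Lambda>" if "G \<subset> F" for G
        using IH[of G] that True finite_subset[of G F] unfolding P_def finite_psubset_def by auto
      moreover have "finite {G. G \<subset> F}"
        using True by (rule_tac finite_subset[of _ "Pow F"]) auto
      ultimately have "\<exists>r\<in>\<Lambda>. \<forall>a\<in>(\<lambda>(c, n). b c n) ` F \<union> f ` {G. G \<subset> F}. R a r"
        using True b by (intro net_index_finite_bound[OF N]) auto
      then show ?thesis unfolding P_def by fastforce
    qed (auto simp: P_def)
  qed
  then obtain h where hP: "\<And>F. P h F (h F)" by blast
  have h\<Lambda>: "h F \<in> \<Lambda>" if "finite F" for F using hP[of F] that unfolding P_def by blast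
  have hb: "R (b c n) (h F)" if "finite F" "(c, n) \<in> F" for F c n
    using hP[of F] that unfolding P_def by blast
  have hm: "R (h G) (h F)" if "finite F" "G \<subset> F" for F G using hP[of F] that unfolding P_def by blast
  have h\<alpha>: "R (\<alpha> n) (h F)" if "finite F" "(c, n) \<in> F" for F c n
    using tr[OF b(2) hb[OF that] \<alpha> b(1) h\<Lambda>[OF that(1)]] .
  let ?L = "{F :: ('a \<times> nat) set. finite F}"
  have inf: "infinite (UNIV :: ('a \<times> nat) set)" by (simp add: finite_prod)
  have N': "net_index ?L (\<subset>)"
    unfolding net_index_def
  proof (intro conjI ballI)
    show "transp_on ?L (\<subset>)" by (auto intro: transp_onI)
    fix G H :: "('a \<times> nat) set" assume GH: "G \<in> ?L" "H \<in> ?L"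
    then obtain p where "p \<notin> G \<union> H" using ex_new_if_finite[OF inf, of "G \<union> H"] by auto
    with GH show "\<exists>K\<in>?L. G \<subset> K \<and> H \<subset> K"
      by (intro bexI[of _ "insert p (G \<union> H)"]) auto
  qed auto
  have Cau': "net_cauchy d ?L (\<subset>) (x \<circ> h)"
    unfolding net_cauchy_def
  proof (intro allI impI)
    fix \<epsilon> :: ennreal assume "\<epsilon> > 0"
    from ennreal_inverse_nat_gap[OF this] obtain n where n: "q n + q n \<le> \<epsilon>"
      unfolding q_def by auto
    have "q n \<le> \<epsilon>"
      using n by (meson add_increasing2 order_refl order_trans zero_le)
    moreover have "d (x (h G)) (x (h H)) < q n"
      if "finite G" "finite H" "{(undefined, n)} \<subset> G" "G \<subset> H" for G H
      using that by (intro \<alpha>C h\<Lambda> hm h\<alpha>[of G undefined n]) auto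
    ultimately have "d (x (h G)) (x (h H)) < \<epsilon>"
      if "finite G" "finite H" "{(undefined, n)} \<subset> G" "G \<subset> H" for G H
      using that by (meson less_le_trans)
    then show "\<exists>A\<in>?L. \<forall>G\<in>?L. \<forall>H\<in>?L. A \<subset> G \<and> G \<subset> H \<longrightarrow> d ((x \<circ> h) G) ((x \<circ> h) H) < \<epsilon>"
      unfolding o_apply by (intro bexI[of _ "{(undefined, n)}"]) (blast | simp)+
  qed
  from C[unfolded dist_complete_def, rule_format, of ?L "(\<subset>)" "x \<circ> h"] N' Cau' xX h\<Lambda>
  obtain l where "limitin (hole_topology X d) (x \<circ> h) l (net_filter ?L (\<subset>))" by auto
  note l = this[unfolded limitin_hole_topology eventually_net_filter[OF N']]
  have sub: "\<exists>F. finite F \<and> (c, n) \<in> F \<and> Q F"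
    if "\<exists>A\<in>?L. \<forall>G\<in>?L. A \<subset> G \<longrightarrow> Q G" for Q c n
  proof -
    from that obtain A where A: "finite A" "\<forall>G\<in>?L. A \<subset> G \<longrightarrow> Q G" by auto
    obtain p where "p \<notin> A" using ex_new_if_finite[OF inf A(1)] by blast
    then have "A \<subset> insert p (insert (c, n) A)" by blast
    with A have "Q (insert p (insert (c, n) A))" by simp
    with A show ?thesis by (intro exI[of _ "insert p (insert (c, n) A)"]) auto
  qed
  have "\<exists>\<beta>\<in>\<Lambda>. \<forall>\<kappa>\<in>\<Lambda>. R \<beta> \<kappa> \<longrightarrow> x \<kappa> \<in> X \<and> \<epsilon> < d (x \<kappa>) c" if c: "c \<in> X" "\<epsilon> < d l c" for c \<epsilon>
  proof -
    from dense[OF c(2)] obtain \<eta> where \<eta>: "\<epsilon> < \<eta>" "\<eta> < d l c" by blast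
    from ennreal_inverse_nat_gap[OF \<eta>(1)] obtain n where n: "\<epsilon> + (q n + q n) \<le> \<eta>"
      unfolding q_def by auto
    from l c(1) \<eta>(2) have "\<exists>A\<in>?L. \<forall>G\<in>?L. A \<subset> G \<longrightarrow> (x \<circ> h) G \<in> X \<and> \<eta> < d ((x \<circ> h) G) c"
      by blast
    from sub[OF this, of c n] obtain F where F: "finite F" "(c, n) \<in> F" "\<eta> < d (x (h F)) c"
      by auto
    have "\<epsilon> < d (x \<kappa>) c" if \<kappa>: "\<kappa> \<in> \<Lambda>" "R (h F) \<kappa>" for \<kappa>
    proof (rule ccontr)
      assume "\<not> \<epsilon> < d (x \<kappa>) c"
      then have le: "d (x \<kappa>) c \<le> \<epsilon>" by simp
      have "d (x (h F)) c \<le> d (x (h F)) (x \<kappa>) + d (x \<kappa>) c"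
        using xX h\<Lambda>[OF F(1)] \<kappa>(1) c(1) by (intro tri) auto
      also have "\<dots> \<le> (q n + q n) + \<epsilon>"
        using \<alpha>C[OF h\<Lambda>[OF F(1)] \<kappa>(1) h\<alpha>[OF F(1,2)] \<kappa>(2)] le
        by (intro add_mono) (auto intro: less_imp_le add_increasing2)
      finally show False using F(3) n by (simp add: add.commute)
    qed
    with h\<Lambda>[OF F(1)] xX show ?thesis by blast
  qed
  moreover
  have "\<exists>\<beta>\<in>\<Lambda>. \<forall>\<kappa>\<in>\<Lambda>. R \<beta> \<kappa> \<longrightarrow> x \<kappa> \<in> X \<and> \<epsilon> < d c (x \<kappa>)" if c: "c \<in> X" "\<epsilon> < d c l" for c \<epsilon>
  proof -
    from dense[OF c(2)] obtain \<eta> where \<eta>: "\<epsilon> < \<eta>" "\<eta> < d c l" by blast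
    from ennreal_inverse_nat_gap[OF \<eta>(1)] obtain n where n: "\<epsilon> + (q n + q n) \<le> \<eta>"
      unfolding q_def by auto
    from l c(1) \<eta>(2) have "\<exists>A\<in>?L. \<forall>G\<in>?L. A \<subset> G \<longrightarrow> (x \<circ> h) G \<in> X \<and> \<eta> < d c ((x \<circ> h) G)"
      by blast
    from sub[OF this, of c n] obtain F where F: "finite F" "(c, n) \<in> F" "\<eta> < d c (x (h F))"
      by auto
    have "\<epsilon> < d c (x \<kappa>)" if \<kappa>: "\<kappa> \<in> \<Lambda>" "R (\<alpha> n) \<kappa>" for \<kappa>
    proof (rule ccontr)
      assume "\<not> \<epsilon> < d c (x \<kappa>)"
      then have le: "d c (x \<kappa>) \<le> \<epsilon>" by simp
      have "d c (x (h F)) \<le> d c (x (b c n)) + d (x (b c n)) (x (h F))"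
        using xX h\<Lambda>[OF F(1)] b(1) c(1) by (intro tri) auto
      also have "\<dots> \<le> (\<epsilon> + q n) + q n"
        using \<alpha>C[OF b(1) h\<Lambda>[OF F(1)] b(2) hb[OF F(1,2)]]
          order_trans[OF bI[OF \<kappa>] add_right_mono[OF le]]
        by (intro add_mono) (auto intro: less_imp_le)
      finally show False using F(3) n by (simp add: add.assoc)
    qed
    with \<alpha>[of n] xX show ?thesis by blast
  qed
  moreover have "l \<in> X" using l by simp
  moreover have "\<exists>\<beta>\<in>\<Lambda>. \<forall>\<kappa>\<in>\<Lambda>. R \<beta> \<kappa> \<longrightarrow> x \<kappa> \<in> X"
    using \<alpha>[of 0] xX by blast
  ultimately have "limitin (hole_topology X d) x l (net_filter \<Lambda> R)"
    unfolding limitin_hole_topology eventually_net_filter[OF N] by (intro conjI ballI allI impI)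
  then show "\<exists>l. limitin (hole_topology X d) x l (net_filter \<Lambda> R)" ..
qed

end

theory Submission
  imports Defs
begin

text \<open>For a \<open>d\<close>-Cauchy net \<open>x\<close> put \<open>\<phi> z = limsup d(z, x\<^sub>i)\<close>. Then \<open>\<phi>(x\<^sub>i)\<close> tends to \<open>0\<close>, and a
  \<open>d\<close>-supremum of a set of zeros of \<open>\<phi>\<close> that comes arbitrarily close above the \<open>x\<^sub>i\<close> is a limit of
  the net. For (1) such a set consists of the points below a whole ball around almost every
  \<open>x\<^sub>i\<close>. For (2) no such set is available: the sublevel sets \<open>{\<phi> < r}\<close> are directed, and their suprema
  form a \<open>d\<^sup>\<or>\<close>-Cauchy sequence as \<open>r\<close> tends to \<open>0\<close>, whose limit works. For (3) all zeros of \<open>\<phi>\<close> are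
  taken: correcting a point with small \<open>\<phi>\<close> again and again, by \<open>e\<close>-summable steps, leads to a zero
  of \<open>\<phi>\<close> that is \<open>e\<close>-close to it. The same correction applied to \<open>d(\<cdot>, y)\<close> turns a small \<open>d(z, y)\<close>
  into \<open>d(w, y) = 0\<close> for some \<open>w\<close> that is \<open>e\<close>-close to \<open>z\<close>; this yields (4) from (3), because in the
  separable case a \<open>d\<close>-directed set can be replaced by an increasing sequence.\<close>

subsection \<open>Positive elements of the extended nonnegative reals\<close>

text \<open>Halving replaces summability: if the step after index \<open>n\<close> costs at most
  \<open>b (Suc n)\<close>, any finite number of steps from there on stays within
  \<open>b n\<close>.\<close>

lemma ennreal_halving_sequence:
  fixes r :: ennreal
  assumes "0 < r"
  obtains b :: "nat \<Rightarrow> ennreal" where "b 0 < r" "\<And>n. 0 < b n" "\<And>n. b (Suc n) + b (Suc n) \<le> b n"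
    "decseq b" "b \<longlonglongrightarrow> 0"
proof -
  \<comment> \<open>\<open>r\<close> may be infinite; a \<open>c\<close> strictly below it is finite
    and can start a real geometric sequence.\<close>
  from dense[OF assms] obtain c where c: "0 < c" "c < r" by blast
  then obtain c' where c': "c = ennreal c'" "0 \<le> c'" by (cases c) auto
  with c have "0 < c'" by (simp add: ennreal_zero_less_divide)
  define b where "b n = ennreal (c' * (1 / 2) ^ n)" for n
  have "b \<longlonglongrightarrow> ennreal (c' * 0)"
    unfolding b_def by (intro tendsto_ennrealI tendsto_mult tendsto_const LIMSEQ_power_zero) simp
  moreover have "b (Suc n) + b (Suc n) = b n" for n
    unfolding b_def using \<open>0 < c'\<close> by (simp add: ennreal_plus[symmetric] field_simps del: ennreal_plus)
  moreover from this have "b (Suc n) \<le> b n" for n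
    by (metis add_increasing2 order_refl zero_le)
  ultimately show thesis
    using c c' \<open>0 < c'\<close> by (intro that[of b]) (auto simp: b_def decseq_Suc_iff)
qed

lemma ennreal_half:
  fixes r :: ennreal
  assumes "0 < r"
  obtains h where "0 < h" "h + h < r" "h < r"
proof -
  obtain b
    where b: "b 0 < r" "0 < b (Suc 0)" "b (Suc 0) + b (Suc 0) \<le> b 0"
      by (rule ennreal_halving_sequence[OF assms]) blast
  moreover have "b (Suc 0) \<le> b (Suc 0) + b (Suc 0)" by (simp add: add_increasing)
  ultimately show thesis by (intro that[of "b (Suc 0)"]) order+
qed

lemma ennreal_gap:
  fixes a c :: ennreal
  assumes "a < c"
  obtains q where "0 < q" "a + q < c"
proof -
  from dense[OF assms] obtain c' where c': "a < c'" "c' < c" by blast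
  from ennreal_inverse_nat_gap[OF c'(1)] obtain n :: nat
    where n: "a + (1 / of_nat (Suc n) + 1 / of_nat (Suc n)) \<le> c'" by blast
  let ?q = "1 / of_nat (Suc n) :: ennreal"
  have "0 < ?q" by (simp add: ennreal_zero_less_divide of_nat_less_top del: of_nat_Suc)
  moreover have "a + ?q \<le> a + (?q + ?q)" by (intro add_left_mono) (simp add: add_increasing)
  ultimately show thesis using n c'(2) by (intro that[of ?q]) order+
qed

lemma ennreal_eq_0_if_le_pos:
  fixes a :: ennreal
  assumes "\<And>t. 0 < t \<Longrightarrow> a \<le> t"
  shows "a = 0"
  using assms dense[of 0 a] by (metis leD not_gr_zero)

lemma ennreal_le_if_le_add_pos:
  fixes a c :: ennreal
  assumes "\<And>t. 0 < t \<Longrightarrow> a \<le> t + c"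
  shows "a \<le> c"
proof (rule ennreal_le_epsilon)
  fix s :: real assume "0 < s"
  with assms[of "ennreal s"] show "a \<le> c + ennreal s" by (simp add: add.commute)
qed

subsection \<open>Distances and the auxiliary functions\<close>

lemma distance_on_triangle:
  "distance_on X d \<Longrightarrow> x \<in> X \<Longrightarrow> z \<in> X \<Longrightarrow> y \<in> X \<Longrightarrow> d x y \<le> d x z + d z y"
  unfolding distance_on_def by blast

lemma distance_on_dist_sym:
  assumes "distance_on X d"
  shows "distance_on X (dist_sym d)"
  unfolding distance_on_def
proof (intro ballI)
  fix x y z assume X: "x \<in> X" "y \<in> X" "z \<in> X"
  have "d x y \<le> dist_sym d x z + dist_sym d z y"
    by (rule order_trans[OF distance_on_triangle[OF assms X(1,3,2)]])
      (auto simp: dist_sym_def intro!: add_mono)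
  moreover have "d y x \<le> d z x + d y z"
    using distance_on_triangle[OF assms X(2,3,1)] by (simp add: add.commute)
  then have "d y x \<le> dist_sym d x z + dist_sym d z y"
    by (rule order_trans) (auto simp: dist_sym_def intro!: add_mono)
  ultimately show "dist_sym d x y \<le> dist_sym d x z + dist_sym d z y"
    unfolding dist_sym_def[of d x y] by simp
qed

lemma precapproxD:
  assumes "precapprox S f g" "0 < t"
  obtains r where "0 < r" "\<And>s. s \<in> S \<Longrightarrow> g s \<le> r \<Longrightarrow> f s < t"
proof -
  have "eventually (\<lambda>r. (SUP s\<in>{s\<in>S. g s \<le> r}. f s) < t) (at_right 0)"
    using assms unfolding precapprox_def by (simp add: order_tendsto_iff)
  then obtain b where b: "0 < b" "\<And>r. 0 < r \<Longrightarrow> r < b \<Longrightarrow> (SUP s\<in>{s\<in>S. g s \<le> r}. f s) < t"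
    unfolding eventually_at_right[OF zero_less_one[where 'a=ennreal]] by blast
  from dense[OF b(1)] obtain r where r: "0 < r" "r < b" by blast
  show thesis
    using SUP_lessD[OF b(2)[OF r]] r(1) by (intro that[of r]) auto
qed

lemma dist_precapproxD:
  assumes "dist_precapprox X f g" "0 < t"
  shows "\<exists>r>0. \<forall>x\<in>X. \<forall>y\<in>X. g x y \<le> r \<longrightarrow> f x y < t"
  by (rule precapproxD[OF assms]) fastforce

text \<open>The supremum over \<epsilon> makes \<open>t\<close> independent of \<epsilon>:
  \<open>z\<close> can be brought arbitrarily close below \<open>y\<close> without leaving the
  \<open>t\<close>-ball around \<open>x\<close>.\<close>

lemma comp_Phi_lessD:
  assumes "comp_Phi X e d x y < t" "0 < \<epsilon>"
  obtains z where "z \<in> X" "d z y < \<epsilon>" "e x z < t"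
proof -
  have "(INF z\<in>{z\<in>X. d z y < \<epsilon>}. e x z) < t"
    using SUP_lessD[OF assms(1)[unfolded comp_Phi_def], of \<epsilon>] assms(2) by simp
  then show thesis using that unfolding INF_less_iff by blast
qed

lemma d_bullet_lessD:
  assumes "d_bullet X d r < t" "x \<in> X"
  obtains y where "y \<in> X" "d x y < t" "\<And>z. z \<in> X \<Longrightarrow> d x z < r \<Longrightarrow> d y z = 0"
proof -
  have "(INF y\<in>{y\<in>X. \<forall>z\<in>upper_ball X d x r. dist_le d y z}. d x y) < t"
    using SUP_lessD[OF assms(1)[unfolded d_bullet_def] assms(2)] .
  then show thesis
    using that unfolding INF_less_iff upper_ball_def dist_le_def by blast
qed

text \<open>The infimum is bounded only non-strictly and need not be attained; the gap between
  \<open>r\<close> and \<open>t\<close> produces an actual \<open>y\<close>.\<close>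

lemma d_fin_leD:
  assumes "\<And>r. d_fin X d r \<le> r" "x \<in> X" "finite A" "A \<subseteq> X" "\<And>z. z \<in> A \<Longrightarrow> d z x < r" "r < t"
  obtains y where "y \<in> X" "d y x < t" "\<And>z. z \<in> A \<Longrightarrow> d z y = 0"
proof -
  let ?I = "\<lambda>x F. INF y\<in>{y\<in>X. \<forall>z\<in>F. dist_le d z y}. d y x"
  have "?I x A \<le> (SUP F\<in>{F. finite F \<and> F \<subseteq> lower_ball X d x r}. ?I x F)"
    using assms(3-5) by (intro SUP_upper) (auto simp: lower_ball_def)
  also have "\<dots> \<le> d_fin X d r"
    unfolding d_fin_def using assms(2) by (intro SUP_upper)
  also have "\<dots> < t" using assms(1)[of r] assms(6) by (rule le_less_trans)
  finally show thesis
    using that unfolding INF_less_iff dist_le_def by blast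
qed

text \<open>In the hole topology \<open>e c w\<close> is at most the limes inferior of
  \<open>e c (z m)\<close>; the choice \<open>c = z n\<close> turns the bound on pairs into a bound
  on the distance to the limit.\<close>

lemma dist_complete_sequence:
  fixes z :: "nat \<Rightarrow> 'a" and b :: "nat \<Rightarrow> ennreal"
  assumes C: "dist_complete TYPE(nat) X e" and z: "\<And>n. z n \<in> X"
    and b: "b \<longlonglongrightarrow> 0" and le: "\<And>n m. n < m \<Longrightarrow> e (z n) (z m) \<le> b n"
  obtains w where "w \<in> X" "\<And>n. e (z n) w \<le> b n"
proof -
  have N: "net_index (UNIV :: nat set) (<)"
    unfolding net_index_def
    by (auto intro!: transp_onI) (meson lessI less_trans less_max_iff_disj max.strict_boundedE)
  have "net_cauchy e UNIV (<) z"
    unfolding net_cauchy_def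
  proof (intro allI impI)
    fix t :: ennreal assume "0 < t"
    with b have "eventually (\<lambda>n. b n < t) sequentially" by (simp add: order_tendsto_iff)
    then obtain n0 where "\<And>n. n0 \<le> n \<Longrightarrow> b n < t"
      by (auto simp: eventually_sequentially)
    then show "\<exists>k\<in>UNIV. \<forall>n\<in>UNIV. \<forall>m\<in>UNIV. k < n \<and> n < m \<longrightarrow> e (z n) (z m) < t"
      by (intro bexI[of _ n0]) (auto intro!: le_less_trans[OF le])
  qed
  with C N z obtain w where w: "limitin (hole_topology X e) z w (net_filter UNIV (<))"
    unfolding dist_complete_def by blast
  note w = w[unfolded limitin_hole_topology eventually_net_filter[OF N]]
  have "e (z n) w \<le> b n" for n
  proof (rule ccontr)
    assume "\<not> e (z n) w \<le> b n"
    then have "b n < e (z n) w" by simp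
    with w z[of n] have "\<exists>k\<in>UNIV. \<forall>m\<in>UNIV. k < m \<longrightarrow> z m \<in> X \<and> b n < e (z n) (z m)"
      by simp
    then obtain k where k: "\<And>m. k < m \<Longrightarrow> b n < e (z n) (z m)" by auto
    have "k < Suc (max k n)" "n < Suc (max k n)" by auto
    from k[OF this(1)] le[OF this(2)] show False by simp
  qed
  with w show thesis by (intro that) auto
qed

subsection \<open>Limits of Cauchy families along a filter\<close>

text \<open>The Cauchy condition is nested: the \<open>j\<close> that count as late may depend on
  \<open>i\<close>. Nets enter through their filter, so all arguments reduce to combining eventual
  statements.\<close>

locale cauchy_family =
  fixes X :: "'a set" and d :: "'a \<Rightarrow> 'a \<Rightarrow> ennreal" and F :: "'i filter" and x :: "'i \<Rightarrow> 'a"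
  assumes dist: "distance_on X d"
    and proper: "F \<noteq> bot"
    and in_X: "eventually (\<lambda>i. x i \<in> X) F"
    and cauchy: "0 < t \<Longrightarrow> eventually (\<lambda>i. eventually (\<lambda>j. d (x i) (x j) < t) F) F"
begin

text \<open>This is the \<open>\<phi>\<close> of the overview; it plays the role of the distance
  from \<open>z\<close> to a limit not yet known to exist.\<close>

definition lim_dist :: "'a \<Rightarrow> ennreal" where
  "lim_dist z = Limsup F (\<lambda>i. d z (x i))"

lemma lim_dist_lessD: "lim_dist z < t \<Longrightarrow> eventually (\<lambda>i. d z (x i) < t) F"
  unfolding lim_dist_def by (rule Limsup_lessD)

lemma lim_dist_leI: "eventually (\<lambda>i. d z (x i) \<le> t) F \<Longrightarrow> lim_dist z \<le> t"
  unfolding lim_dist_def by (rule Limsup_bounded)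

lemma lim_dist_triangle:
  assumes "z \<in> X" "w \<in> X"
  shows "lim_dist z \<le> d z w + lim_dist w"
proof (rule ennreal_le_if_le_add_pos)
  fix t :: ennreal assume t: "0 < t"
  show "lim_dist z \<le> t + (d z w + lim_dist w)"
  \<comment> \<open>Only a finite value leaves room for a strict inequality above it; at
    \<open>top\<close> the claim is trivial.\<close>
  proof (cases "lim_dist w = top")
    case False
    with t have "lim_dist w < lim_dist w + t"
      by (metis add.right_neutral ennreal_add_left_cancel_less infinity_ennreal_def)
    from lim_dist_lessD[OF this] in_X
    have "eventually (\<lambda>i. d z (x i) \<le> t + (d z w + lim_dist w)) F"
    proof eventually_elim
      case (elim i)
      have "d z (x i) \<le> d z w + d w (x i)" by (rule distance_on_triangle[OF dist assms elim(2)])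
      also have "\<dots> \<le> d z w + (lim_dist w + t)" using elim(1) by (intro add_left_mono) auto
      finally show ?case by (simp add: ac_simps)
    qed
    then show ?thesis by (rule lim_dist_leI)
  qed simp
qed

lemma eventually_lim_dist_less: "0 < t \<Longrightarrow> eventually (\<lambda>i. lim_dist (x i) < t) F"
proof -
  assume "0 < t"
  then obtain h where h: "0 < h" "h < t" by (rule ennreal_half)
  from cauchy[OF h(1)] show ?thesis
    by eventually_elim (rule le_less_trans[OF lim_dist_leI h(2)], auto elim: eventually_mono)
qed

text \<open>The triangle inequality through \<open>x i\<close> is read backwards: a point with small
  \<open>lim_dist\<close> bounds \<open>d (x i) c\<close> from below.\<close>

lemma dist_le_lim_dist_plus:
  assumes "z \<in> X" "c \<in> X" "lim_dist z < t"
  shows "eventually (\<lambda>i. d z c \<le> t + d (x i) c) F"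
  using lim_dist_lessD[OF assms(3)] in_X
proof eventually_elim
  case (elim i)
  then show ?case
    by (meson add_right_mono assms(1,2) dist distance_on_triangle less_imp_le order_trans)
qed

text \<open>The lower bound on \<open>d c (x i)\<close> comes for free from small
  \<open>d (x i) s\<close>, by the triangle inequality through \<open>x i\<close>. The slack
  \<open>t\<close> avoids subtraction in the extended reals.\<close>

lemma limitin_if_liminf:
  assumes s: "s \<in> X" and below: "\<And>t. 0 < t \<Longrightarrow> eventually (\<lambda>i. d (x i) s \<le> t) F"
    and above: "\<And>c t a. c \<in> X \<Longrightarrow> 0 < t \<Longrightarrow> a < d s c \<Longrightarrow> eventually (\<lambda>i. a < t + d (x i) c) F"
  shows "limitin (hole_topology X d) x s F"
  unfolding limitin_hole_topology
proof (intro conjI ballI allI impI)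
  fix c a assume c: "c \<in> X" and a: "a < d s c"
  from ennreal_gap[OF a] obtain q where q: "0 < q" "a + q < d s c" .
  from above[OF c q] in_X show "eventually (\<lambda>i. x i \<in> X \<and> a < d (x i) c) F"
  proof eventually_elim
    case (elim i)
    then show ?case by (metis add.commute add_left_mono leD leI)
  qed
next
  fix c a assume c: "c \<in> X" and a: "a < d c s"
  from ennreal_gap[OF a] obtain q where q: "0 < q" "a + q < d c s" .
  from below[OF q(1)] in_X show "eventually (\<lambda>i. x i \<in> X \<and> a < d c (x i)) F"
  proof eventually_elim
    case (elim i)
    have "d c s \<le> d c (x i) + q"
      using distance_on_triangle[OF dist c elim(2) s] elim(1) by (meson add_left_mono order_trans)
    with q(2) have "a + q < d c (x i) + q" by (rule less_le_trans)
    with elim(2) show ?case by (meson add_right_mono leD leI)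
  qed
qed (use s in_X in auto)

text \<open>Points of \<open>Y\<close> near \<open>x i\<close> lie below \<open>s\<close>, so
  \<open>d (x i) s\<close> is small; the supremum formula replaces \<open>s\<close> by some
  \<open>y\<close> in \<open>Y\<close>, where \<open>lim_dist\<close> vanishes, which bounds
  \<open>d (x i) c\<close> from below.\<close>

lemma limitin_dist_supremum:
  assumes s: "dist_supremum X d Y s" and Y: "Y \<subseteq> X" "\<And>y. y \<in> Y \<Longrightarrow> lim_dist y = 0"
    and near: "\<And>t. 0 < t \<Longrightarrow> eventually (\<lambda>i. \<exists>y\<in>Y. d (x i) y < t) F"
  shows "limitin (hole_topology X d) x s F"
proof (rule limitin_if_liminf)
  show sX: "s \<in> X" using s unfolding dist_supremum_def by blast
  show "eventually (\<lambda>i. d (x i) s \<le> t) F" if "0 < t" for t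
    using near[OF that] in_X
  proof eventually_elim
    case (elim i)
    then obtain y where y: "y \<in> Y" "d (x i) y < t" by blast
    moreover from s y have "d y s = 0" unfolding dist_supremum_def dist_le_def by blast
    moreover have "d (x i) s \<le> d (x i) y + d y s"
      using distance_on_triangle[OF dist] elim(2) Y(1) y(1) sX by blast
    ultimately show ?case by simp
  qed
  show "eventually (\<lambda>i. a < t + d (x i) c) F" if c: "c \<in> X" and t: "0 < t" and a: "a < d s c" for c t a
  proof -
    have "d s c = (SUP y\<in>Y. d y c)" using s c unfolding dist_supremum_def by blast
    with a obtain y where y: "y \<in> Y" "a < d y c" by (auto simp: less_SUP_iff)
    have "eventually (\<lambda>i. d y c \<le> t + d (x i) c) F"
      using y Y c t by (intro dist_le_lim_dist_plus) auto
    then show ?thesis by eventually_elim (rule less_le_trans[OF y(2)])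
  qed
qed

section \<open>Condition (1): lower bounds of whole balls\<close>

lemma limit_if_d_bullet:
  assumes C: "dist_le_directed_complete X d" and B: "precapprox UNIV (d_bullet X d) id"
  shows "\<exists>s. limitin (hole_topology X d) x s F"
proof -
  \<comment> \<open>The radius is chosen before \<open>i\<close>, so finitely many points of
    \<open>Y\<close> share one radius.\<close>
  define Y where "Y = {y\<in>X. \<exists>r>0. eventually (\<lambda>i. \<forall>z\<in>X. d (x i) z < r \<longrightarrow> d y z = 0) F}"
  have near: "eventually (\<lambda>i. \<exists>y\<in>Y. d (x i) y < t) F" if "0 < t" for t
  proof -
    from precapproxD[OF B that] obtain r where r: "0 < r" "d_bullet X d r < t"
      by (metis UNIV_I id_apply order_refl)
    \<comment> \<open>When \<open>d (x i) (x j) < h\<close>, the \<open>h\<close>-ball at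
      \<open>x j\<close> lies in the \<open>r\<close>-ball at \<open>x i\<close>, so one
      \<open>y\<close> below the latter serves almost all \<open>j\<close>.\<close>
    from r(1) obtain h where h: "0 < h" "h + h < r" by (rule ennreal_half)
    from cauchy[OF h(1)] in_X show ?thesis
    proof eventually_elim
      case (elim i)
      from d_bullet_lessD[OF r(2) elim(2)] obtain y where y: "y \<in> X" "d (x i) y < t"
        "\<And>z. z \<in> X \<Longrightarrow> d (x i) z < r \<Longrightarrow> d y z = 0" by metis
      from elim(1) in_X have "eventually (\<lambda>j. \<forall>z\<in>X. d (x j) z < h \<longrightarrow> d y z = 0) F"
      proof eventually_elim
        case (elim j)
        show ?case
        proof (intro ballI impI)
          fix z assume z: "z \<in> X" "d (x j) z < h"
          have "d (x i) z \<le> d (x i) (x j) + d (x j) z"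
            using distance_on_triangle[OF dist] \<open>x i \<in> X\<close> elim(2) z(1) by blast
          also have "\<dots> \<le> h + h" using elim(1) z(2) by (intro add_mono) auto
          finally show "d y z = 0" using y(3) z(1) h(2) by auto
        qed
      qed
      with y h(1) show ?case unfolding Y_def by blast
    qed
  qed
  have "lim_dist y = 0" if "y \<in> Y" for y
  proof -
    from that obtain r where r: "0 < r" "eventually (\<lambda>i. \<forall>z\<in>X. d (x i) z < r \<longrightarrow> d y z = 0) F"
      unfolding Y_def by blast
    from eventually_happens'[OF proper eventually_conj[OF r(2) cauchy[OF r(1)]]]
    obtain i where i: "\<forall>z\<in>X. d (x i) z < r \<longrightarrow> d y z = 0" "eventually (\<lambda>j. d (x i) (x j) < r) F"
      by blast
    from i(2) in_X have "eventually (\<lambda>j. d y (x j) \<le> 0) F"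
      by eventually_elim (use i(1) in auto)
    from lim_dist_leI[OF this] show ?thesis by simp
  qed
  moreover have "dist_le_directed d Y"
    unfolding dist_le_directed_def
  proof (intro allI impI, elim conjE)
    fix A assume A: "finite A" "A \<subseteq> Y"
    then have "\<exists>r>0. eventually (\<lambda>i. \<forall>y\<in>A. \<forall>z\<in>X. d (x i) z < r \<longrightarrow> d y z = 0) F"
    proof (induction A)
      case empty
      then show ?case by (intro exI[of _ 1]) simp
    next
      case (insert a A)
      then obtain r r' where "0 < r" "eventually (\<lambda>i. \<forall>y\<in>A. \<forall>z\<in>X. d (x i) z < r \<longrightarrow> d y z = 0) F"
        "0 < r'" "eventually (\<lambda>i. \<forall>z\<in>X. d (x i) z < r' \<longrightarrow> d a z = 0) F"
        unfolding Y_def by auto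
      then show ?case
        by (intro exI[of _ "min r r'"]) (auto elim: eventually_elim2)
    qed
    then obtain r where r: "0 < r" "eventually (\<lambda>i. \<forall>y\<in>A. \<forall>z\<in>X. d (x i) z < r \<longrightarrow> d y z = 0) F"
      by blast
    \<comment> \<open>A point of \<open>Y\<close> inside the \<open>r\<close>-ball at
      \<open>x i\<close> lies exactly above every element of \<open>A\<close>.\<close>
    from eventually_happens'[OF proper eventually_conj[OF r(2) near[OF r(1)]]]
    show "\<exists>y\<in>Y. \<forall>z\<in>A. dist_le d z y"
      unfolding dist_le_def Y_def by blast
  qed
  moreover have "Y \<subseteq> X" unfolding Y_def by blast
  ultimately show ?thesis
    using C near limitin_dist_supremum unfolding dist_le_directed_complete_def by meson
qed

section \<open>Condition (2): suprema of sublevel sets\<close>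

lemma limit_if_d_fin:
  assumes C: "dist_le_directed_complete X d" and C': "dist_complete TYPE(nat) X (dist_sym d)"
    and fin: "\<And>r. d_fin X d r \<le> r"
  shows "\<exists>s. limitin (hole_topology X d) x s F"
proof -
  define S where "S r = {z\<in>X. lim_dist z < r}" for r
  have S_directed: "dist_le_directed d (S r)" if r: "0 < r" for r
    unfolding dist_le_directed_def
  proof (intro allI impI, elim conjE)
    fix A assume A: "finite A" "A \<subseteq> S r"
    \<comment> \<open>The margin between \<open>p\<close> and \<open>r\<close> is spent twice below:
      \<open>p'\<close> pays for the strictness in \<open>d_fin_leD\<close>, \<open>q\<close> for
      the value of \<open>lim_dist\<close> at \<open>x i\<close>.\<close>
    have "\<exists>p<r. \<forall>z\<in>A. lim_dist z < p"
      using A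
    proof (induction A)
      case empty
      then show ?case using r by auto
    next
      case (insert a A)
      then obtain p where p: "p < r" "\<forall>z\<in>A. lim_dist z < p" by auto
      have "lim_dist a < r" using insert.prems unfolding S_def by auto
      from dense[OF this] obtain q where "lim_dist a < q" "q < r" by blast
      with p show ?case by (intro exI[of _ "max p q"]) (auto simp: less_max_iff_disj)
    qed
    then obtain p where p: "p < r" "\<forall>z\<in>A. lim_dist z < p" by blast
    from dense[OF p(1)] obtain p' where p': "p < p'" "p' < r" by blast
    from ennreal_gap[OF p'(2)] obtain q where q: "0 < q" "p' + q < r" .
    have "eventually (\<lambda>i. \<forall>z\<in>A. d z (x i) < p) F"
      using p(2) by (intro eventually_ball_finite A ballI lim_dist_lessD) auto
    from eventually_happens'[OF proper eventually_conj[OF this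
        eventually_conj[OF in_X eventually_lim_dist_less[OF q(1)]]]]
    obtain i where i: "\<And>z. z \<in> A \<Longrightarrow> d z (x i) < p" "x i \<in> X" "lim_dist (x i) < q"
      by blast
    have "A \<subseteq> X" using A unfolding S_def by blast
    from d_fin_leD[OF fin i(2) A(1) this i(1) p'(1)]
    obtain y where y: "y \<in> X" "d y (x i) < p'" "\<And>z. z \<in> A \<Longrightarrow> d z y = 0"
      by metis
    have "lim_dist y \<le> d y (x i) + lim_dist (x i)" by (rule lim_dist_triangle[OF y(1) i(2)])
    also have "\<dots> \<le> p' + q" using y(2) i(3) by (intro add_mono) auto
    also have "\<dots> < r" by (rule q(2))
    finally show "\<exists>y\<in>S r. \<forall>z\<in>A. dist_le d z y"
      using y unfolding S_def dist_le_def by auto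
  qed
  obtain b :: "nat \<Rightarrow> ennreal"
    where b: "\<And>n. 0 < b n" "decseq b" "b \<longlonglongrightarrow> 0"
      by (rule ennreal_halving_sequence[OF zero_less_one]) blast
  have "\<exists>s. dist_supremum X d (S (b n)) s" for n
  proof -
    have "S (b n) \<subseteq> X" unfolding S_def by blast
    with C S_directed[OF b(1)[of n]] show ?thesis unfolding dist_le_directed_complete_def by blast
  qed
  then obtain s where s: "\<And>n. dist_supremum X d (S (b n)) (s n)" by metis
  have sX: "s n \<in> X" and le_s: "\<And>z. z \<in> S (b n) \<Longrightarrow> d z (s n) = 0"
    and s_sup: "\<And>c. c \<in> X \<Longrightarrow> d (s n) c = (SUP y\<in>S (b n). d y c)" for n
    using s[of n] unfolding dist_supremum_def dist_le_def by auto
  have x_le_s: "eventually (\<lambda>i. d (x i) (s n) = 0) F" for n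
    using in_X eventually_lim_dist_less[OF b(1)[of n]]
    by eventually_elim (auto intro!: le_s simp: S_def)
  have s_close: "dist_sym d (s n) (s m) \<le> b n" if "n < m" for n m
  proof -
    have "b m \<le> b n" using b(2) that by (simp add: decseqD)
    then have "S (b m) \<subseteq> S (b n)" unfolding S_def by auto
    \<comment> \<open>The distance is even \<open>0\<close>, since every point of
      \<open>S (b m)\<close> lies below \<open>s n\<close>.\<close>
    then have "d (s m) (s n) \<le> b n"
      unfolding s_sup[OF sX] by (intro SUP_least) (use le_s in auto)
    moreover have "d (s n) (s m) \<le> b n"
      unfolding s_sup[OF sX]
    proof (rule SUP_least)
      fix y assume y: "y \<in> S (b n)"
      \<comment> \<open>Almost every \<open>x i\<close> is within \<open>b n\<close> of
        \<open>y\<close> and at the same time below \<open>s m\<close>.\<close>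
      then have "eventually (\<lambda>i. d y (x i) < b n) F"
        unfolding S_def by (auto intro: lim_dist_lessD)
      from eventually_happens'[OF proper eventually_conj[OF this eventually_conj[OF in_X x_le_s[of m]]]]
      obtain i where i: "d y (x i) < b n" "x i \<in> X" "d (x i) (s m) = 0" by blast
      have "d y (s m) \<le> d y (x i) + d (x i) (s m)"
        using distance_on_triangle[OF dist _ i(2) sX] y unfolding S_def by blast
      with i show "d y (s m) \<le> b n" by simp
    qed
    ultimately show ?thesis unfolding dist_sym_def by simp
  qed
  from dist_complete_sequence[OF C' sX b(3) s_close]
  obtain w where w: "w \<in> X" "\<And>n. dist_sym d (s n) w \<le> b n" by metis
  have "limitin (hole_topology X d) x w F"
  proof (rule limitin_if_liminf[OF w(1)])
    fix t :: ennreal assume "0 < t"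
    with b(3) have "eventually (\<lambda>n. b n < t) sequentially" by (simp add: order_tendsto_iff)
    then obtain n where n: "b n < t" by (auto simp: eventually_sequentially)
    from x_le_s[of n] in_X show "eventually (\<lambda>i. d (x i) w \<le> t) F"
    proof eventually_elim
      case (elim i)
      have "d (x i) w \<le> d (x i) (s n) + d (s n) w"
        by (rule distance_on_triangle[OF dist elim(2) sX w(1)])
      also have "\<dots> \<le> t" using elim(1) w(2)[of n] n by (auto simp: dist_sym_def)
      finally show ?case .
    qed
  next
    fix c t a assume c: "c \<in> X" and t: "0 < (t :: ennreal)" and a: "a < d w c"
    \<comment> \<open>One \<open>h\<close> covers the step from \<open>w\<close> to
      \<open>s n\<close>, the other the possibly nonzero \<open>lim_dist\<close> of the point
      \<open>y\<close> that replaces \<open>s n\<close>.\<close>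
    from t obtain h where h: "0 < h" "h + h < t" by (rule ennreal_half)
    with b(3) have "eventually (\<lambda>n. b n < h) sequentially" by (simp add: order_tendsto_iff)
    then obtain n where n: "b n < h" by (auto simp: eventually_sequentially)
    have "d w c \<le> d w (s n) + d (s n) c"
      by (rule distance_on_triangle[OF dist w(1) sX c])
    also have "\<dots> \<le> h + d (s n) c"
      using w(2)[of n] n by (intro add_right_mono) (auto simp: dist_sym_def)
    also have "\<dots> = (SUP y\<in>S (b n). h + d y c)"
    proof -
      \<comment> \<open>Adding \<open>h\<close> commutes with the supremum only over a nonempty set,
        the empty supremum being \<open>0\<close>.\<close>
      from eventually_happens'[OF proper eventually_conj[OF in_X eventually_lim_dist_less[OF b(1)[of n]]]]
      have "S (b n) \<noteq> {}" unfolding S_def by auto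
      then show ?thesis unfolding s_sup[OF c] by (rule ennreal_SUP_add_right)
    qed
    finally have "a < (SUP y\<in>S (b n). h + d y c)" using a by (rule less_le_trans[rotated])
    then obtain y where y: "y \<in> S (b n)" "a < h + d y c" unfolding less_SUP_iff by blast
    then have "eventually (\<lambda>i. d y c \<le> h + d (x i) c) F"
      using n c unfolding S_def by (intro dist_le_lim_dist_plus) auto
    then show "eventually (\<lambda>i. a < t + d (x i) c) F"
    proof eventually_elim
      case (elim i)
      have "a < h + (h + d (x i) c)" using y(2) add_left_mono[OF elim] by (rule less_le_trans)
      also have "\<dots> = (h + h) + d (x i) c" by (simp add: add.assoc)
      also have "\<dots> \<le> t + d (x i) c" using h by (intro add_right_mono) auto
      finally show ?case .
    qed
  qed
  then show ?thesis ..
qed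

end

subsection \<open>Completeness with respect to a finer symmetric distance\<close>

text \<open>Completeness is taken over the index type \<open>nat\<close> because the
  \<open>e\<close>-limits formed below are limits of sequences of corrections.\<close>

locale metric_refinement =
  fixes X :: "'a set" and d e :: "'a \<Rightarrow> 'a \<Rightarrow> ennreal"
  assumes dist_d: "distance_on X d" and dist_e: "distance_on X e"
    and complete: "dist_complete TYPE(nat) X e"
    and comp_Phi: "dist_precapprox X (comp_Phi X e d) d"
    and finer: "dist_precapprox X d e"
    and sym: "x \<in> X \<Longrightarrow> y \<in> X \<Longrightarrow> e x y = e y x"
begin

text \<open>Induction on the number of steps: the first step and all the remaining ones cost at most
  \<open>b (Suc n)\<close> each, and halving absorbs both into \<open>b n\<close>.\<close>

lemma e_limit:
  assumes z: "\<And>n. z n \<in> X" and b: "\<And>n. b (Suc n) + b (Suc n) \<le> b n" "b \<longlonglongrightarrow> 0"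
    and step: "\<And>n. e (z n) (z (Suc n)) \<le> b (Suc n)"
  obtains w where "w \<in> X" "\<And>n. e (z n) w \<le> b n"
proof -
  have le: "b (Suc n) \<le> b n" for n
    by (rule order_trans[OF _ b(1)]) (simp add: add_increasing)
  have "e (z n) (z (Suc (n + k))) \<le> b n" for n k
  proof (induction k arbitrary: n)
    case 0
    show ?case using step[of n] le[of n] by simp
  next
    case (Suc k)
    have "e (z n) (z (Suc (n + Suc k))) \<le> e (z n) (z (Suc n)) + e (z (Suc n)) (z (Suc (Suc n + k)))"
      using distance_on_triangle[OF dist_e z z z, of n "Suc (Suc n + k)" "Suc n"] by simp
    also have "\<dots> \<le> b (Suc n) + b (Suc n)" by (rule add_mono[OF step Suc.IH])
    also have "\<dots> \<le> b n" by (rule b)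
    finally show ?case .
  qed
  then have "e (z n) (z m) \<le> b n" if "n < m" for n m
    using less_imp_Suc_add[OF that] by auto
  then obtain w where "w \<in> X" "\<And>n. e (z n) w \<le> b n"
    by (rule dist_complete_sequence[of X e z b, OF complete z b(2)]) blast+
  then show thesis by (rule that)
qed

lemma d_small:
  assumes "0 < t"
  shows "\<exists>r>0. \<forall>x\<in>X. \<forall>y\<in>X. e x y \<le> r \<longrightarrow> d x y < t \<and> d y x < t"
proof -
  from dist_precapproxD[OF finer assms] obtain r
    where "0 < r" "\<And>x y. x \<in> X \<Longrightarrow> y \<in> X \<Longrightarrow> e x y \<le> r \<Longrightarrow> d x y < t"
      by blast
  then show ?thesis using sym by (intro exI[of _ r]) simp
qed

lemma comp_Phi_small:
  assumes "0 < t"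
  shows "\<exists>r>0. \<forall>x\<in>X. \<forall>y\<in>X. d x y \<le> r \<longrightarrow> (\<forall>\<epsilon>>0. \<exists>z\<in>X. d z y < \<epsilon> \<and> e x z < t)"
proof -
  from dist_precapproxD[OF comp_Phi assms] obtain r where r: "0 < r"
    "\<And>x y. x \<in> X \<Longrightarrow> y \<in> X \<Longrightarrow> d x y \<le> r \<Longrightarrow> comp_Phi X e d x y < t"
      by blast
  have "\<exists>z\<in>X. d z y < \<epsilon> \<and> e x z < t" if "x \<in> X" "y \<in> X" "d x y \<le> r" "0 < \<epsilon>" for x y \<epsilon>
    by (rule comp_Phi_lessD[OF r(2)[OF that(1-3)] that(4)]) blast
  with r(1) show ?thesis by blast
qed

text \<open>A set of functions is treated at once because \<open>\<delta>\<close> has to be uniform in \<open>y\<close> when this is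
  applied to the functions \<open>d(\<cdot>, y)\<close>.\<close>

lemma exact_zero_nearby:
  fixes \<Phi> :: "('a \<Rightarrow> ennreal) set"
  assumes tri: "\<And>\<phi> z w. \<phi> \<in> \<Phi> \<Longrightarrow> z \<in> X \<Longrightarrow> w \<in> X \<Longrightarrow> \<phi> z \<le> d z w + \<phi> w"
    and approx: "\<And>r. 0 < r \<Longrightarrow>
      \<exists>\<delta>>0. \<forall>\<phi>\<in>\<Phi>. \<forall>z\<in>X. \<phi> z < \<delta> \<longrightarrow> (\<forall>\<epsilon>>0. \<exists>z'\<in>X. e z z' < r \<and> \<phi> z' < \<epsilon>)"
    and r: "0 < r"
  shows "\<exists>\<delta>>0. \<forall>\<phi>\<in>\<Phi>. \<forall>z\<in>X. \<phi> z < \<delta> \<longrightarrow> (\<exists>w\<in>X. e z w < r \<and> \<phi> w = 0)"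
proof -
  obtain b :: "nat \<Rightarrow> ennreal"
    where b: "b 0 < r" "\<And>n. 0 < b n" "\<And>n. b (Suc n) + b (Suc n) \<le> b n" "b \<longlonglongrightarrow> 0"
    by (rule ennreal_halving_sequence[OF r]) blast
  have "\<forall>n. \<exists>\<delta>>0. \<forall>\<phi>\<in>\<Phi>. \<forall>z\<in>X. \<phi> z < \<delta> \<longrightarrow> (\<forall>\<epsilon>>0. \<exists>z'\<in>X. e z z' < b (Suc n) \<and> \<phi> z' < \<epsilon>)"
    using approx b(2) by blast
  then obtain \<delta> where \<delta>: "\<And>n. 0 < \<delta> n" "\<And>n \<phi> z \<epsilon>. \<phi> \<in> \<Phi> \<Longrightarrow> z \<in> X \<Longrightarrow> \<phi> z < \<delta> n \<Longrightarrow> 0 < \<epsilon> \<Longrightarrow>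
      \<exists>z'\<in>X. e z z' < b (Suc n) \<and> \<phi> z' < \<epsilon>"
    by metis
  \<comment> \<open>The bound \<open>\<delta> n\<close> permits the next correction, and
    \<open>b n\<close> forces \<phi> to tend to \<open>0\<close> along the sequence.\<close>
  define \<rho> where "\<rho> n = min (\<delta> n) (b n)" for n
  have \<rho>: "0 < \<rho> n" for n using \<delta>(1) b(2) unfolding \<rho>_def by simp
  have "\<exists>w\<in>X. e z w < r \<and> \<phi> w = 0" if \<phi>: "\<phi> \<in> \<Phi>" and z: "z \<in> X" "\<phi> z < \<rho> 0" for \<phi> z
  proof -
    have "\<exists>f. \<forall>n. (f n \<in> X \<and> \<phi> (f n) < \<rho> n \<and> (n = 0 \<longrightarrow> f n = z)) \<and> e (f n) (f (Suc n)) < b (Suc n)"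
    proof (rule dependent_nat_choice)
      show "\<exists>f. f \<in> X \<and> \<phi> f < \<rho> 0 \<and> (0 = (0 :: nat) \<longrightarrow> f = z)"
        using z by blast
      fix u and n :: nat assume "u \<in> X \<and> \<phi> u < \<rho> n \<and> (n = 0 \<longrightarrow> u = z)"
      then show "\<exists>v. (v \<in> X \<and> \<phi> v < \<rho> (Suc n) \<and> (Suc n = 0 \<longrightarrow> v = z)) \<and> e u v < b (Suc n)"
        using \<delta>(2)[OF \<phi>, of u n, OF _ _ \<rho>[of "Suc n"]] unfolding \<rho>_def by auto
    qed
    then obtain f where f: "\<And>n. f n \<in> X" "\<And>n. \<phi> (f n) < \<rho> n" "f 0 = z"
      "\<And>n. e (f n) (f (Suc n)) < b (Suc n)" by blast
    from e_limit[OF f(1) b(3,4) less_imp_le[OF f(4)]]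
    obtain w where w: "w \<in> X" "\<And>n. e (f n) w \<le> b n" by blast
    \<comment> \<open>\<open>\<phi> w \<le> d w (f n) + \<phi> (f n)\<close>, and both terms tend to
      \<open>0\<close>; the first is measured from the limit back to the sequence, which
      \<open>d_small\<close> controls as well.\<close>
    have "\<phi> w = 0"
    proof (rule ennreal_eq_0_if_le_pos)
      fix t :: ennreal assume "0 < t"
      then obtain h where h: "0 < h" "h + h < t" by (rule ennreal_half)
      obtain q where q: "0 < q"
        "\<And>x y. x \<in> X \<Longrightarrow> y \<in> X \<Longrightarrow> e x y \<le> q \<Longrightarrow> d x y < h \<and> d y x < h"
          using d_small[OF h(1)] by blast
      from b(4) q(1) h(1) have "eventually (\<lambda>n. b n < q \<and> b n < h) sequentially"
        by (simp add: order_tendsto_iff eventually_conj_iff)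
      then obtain n where n: "b n < q" "b n < h" by (auto simp: eventually_sequentially)
      have "d w (f n) < h"
        using q(2)[OF f(1) w(1)] w(2)[of n] n(1) by (meson less_imp_le order_trans)
      moreover have "\<phi> (f n) < h" using f(2)[of n] n(2) unfolding \<rho>_def by auto
      ultimately have "d w (f n) + \<phi> (f n) \<le> h + h" by (intro add_mono) auto
      with tri[OF \<phi> w(1) f(1)[of n]] h(2) show "\<phi> w \<le> t" by order
    qed
    moreover have "e z w < r" using w(2)[of 0] f(3) b(1) by auto
    ultimately show ?thesis using w(1) by blast
  qed
  with \<rho>[of 0] show ?thesis by blast
qed

section \<open>Condition (3): the set of all zeros of \<open>lim_dist\<close>\<close>

lemma limit_if_directed_complete:
  assumes C: "dist_directed_complete X d" and F: "cauchy_family X d F x"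
  shows "\<exists>s. limitin (hole_topology X d) x s F"
proof -
  interpret cauchy_family X d F x by (rule F)
  define Z where "Z = {z\<in>X. lim_dist z = 0}"
  \<comment> \<open>Some \<open>x i\<close> is close above \<open>z\<close> and has tiny
    \<open>lim_dist\<close>; moving \<open>z\<close> slightly in \<open>e\<close> brings it as close
    below that \<open>x i\<close> as desired.\<close>
  have approx: "\<exists>\<delta>>0. \<forall>z\<in>X. lim_dist z < \<delta> \<longrightarrow> (\<forall>\<epsilon>>0. \<exists>z'\<in>X. e z z' < r \<and> lim_dist z' < \<epsilon>)"
    if r: "0 < r" for r
  proof -
    obtain \<delta> where \<delta>: "0 < \<delta>"
      "\<And>x y \<epsilon>. x \<in> X \<Longrightarrow> y \<in> X \<Longrightarrow> d x y \<le> \<delta> \<Longrightarrow> 0 < \<epsilon> \<Longrightarrow> \<exists>z\<in>X. d z y < \<epsilon> \<and> e x z < r"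
      using comp_Phi_small[OF r] by blast
    have "\<exists>z'\<in>X. e z z' < r \<and> lim_dist z' < \<epsilon>" if z: "z \<in> X" "lim_dist z < \<delta>" and \<epsilon>: "0 < \<epsilon>" for z \<epsilon>
    proof -
      from \<epsilon> obtain h where h: "0 < h" "h + h < \<epsilon>" by (rule ennreal_half)
      from eventually_happens'[OF proper eventually_conj[OF lim_dist_lessD[OF z(2)]
          eventually_conj[OF in_X eventually_lim_dist_less[OF h(1)]]]]
      obtain i where i: "d z (x i) < \<delta>" "x i \<in> X" "lim_dist (x i) < h" by blast
      from \<delta>(2)[OF z(1) i(2) less_imp_le[OF i(1)] h(1)]
      obtain z' where z': "z' \<in> X" "d z' (x i) < h" "e z z' < r" by blast
      have "lim_dist z' \<le> d z' (x i) + lim_dist (x i)"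
        by (rule lim_dist_triangle[OF z'(1) i(2)])
      also have "\<dots> \<le> h + h" using z'(2) i(3) by (intro add_mono) auto
      finally show ?thesis using z' h(2) by auto
    qed
    with \<delta>(1) show ?thesis by blast
  qed
  have near: "eventually (\<lambda>i. \<exists>y\<in>Z. d (x i) y < t) F" if t: "0 < t" for t
  proof -
    obtain r where r: "0 < r"
      "\<And>x y. x \<in> X \<Longrightarrow> y \<in> X \<Longrightarrow> e x y \<le> r \<Longrightarrow> d x y < t \<and> d y x < t"
        using d_small[OF t] by blast
    have "\<exists>\<delta>>0. \<forall>\<phi>\<in>{lim_dist}. \<forall>z\<in>X. \<phi> z < \<delta> \<longrightarrow> (\<exists>w\<in>X. e z w < r \<and> \<phi> w = 0)"
    proof (rule exact_zero_nearby[OF _ _ r(1)])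
      show "\<phi> z \<le> d z w + \<phi> w" if "\<phi> \<in> {lim_dist}" "z \<in> X" "w \<in> X" for \<phi> z w
        using that lim_dist_triangle by simp
    qed (use approx in simp)
    then obtain \<delta> where \<delta>: "0 < \<delta>"
      "\<And>z. z \<in> X \<Longrightarrow> lim_dist z < \<delta> \<Longrightarrow> \<exists>w\<in>X. e z w < r \<and> lim_dist w = 0"
        by blast
    from in_X eventually_lim_dist_less[OF \<delta>(1)] show ?thesis
    proof eventually_elim
      case (elim i)
      from \<delta>(2)[OF elim] obtain w where w: "w \<in> X" "e (x i) w < r" "lim_dist w = 0"
        by blast
      with r(2)[OF elim(1), of w] show ?case unfolding Z_def by auto
    qed
  qed
  have "dist_directed d Z"
    unfolding dist_directed_def
  proof (intro allI impI, elim conjE)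
    fix A assume A: "finite A" "A \<subseteq> Z"
    \<comment> \<open>The detour through \<open>x i\<close> gives upper bounds of \<open>A\<close>
      only up to \<open>h + h\<close>, so \<open>Z\<close> is shown to be \<open>d\<close>-directed
      rather than directed in the order.\<close>
    show "(INF y\<in>Z. SUP z\<in>A. d z y) = 0"
    proof (rule ennreal_eq_0_if_le_pos)
      fix t :: ennreal assume "0 < t"
      then obtain h where h: "0 < h" "h + h < t" by (rule ennreal_half)
      have "eventually (\<lambda>i. \<forall>z\<in>A. d z (x i) < h) F"
        using A h(1) unfolding Z_def by (intro eventually_ball_finite ballI lim_dist_lessD) auto
      from eventually_happens'[OF proper eventually_conj[OF this eventually_conj[OF in_X near[OF h(1)]]]]
      obtain i y where i: "\<And>z. z \<in> A \<Longrightarrow> d z (x i) < h" "x i \<in> X" "y \<in> Z" "d (x i) y < h"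
        by blast
      have "d z y \<le> t" if z: "z \<in> A" for z
      proof -
        have "z \<in> X" "y \<in> X" using A(2) z i(3) unfolding Z_def by auto
        then have "d z y \<le> d z (x i) + d (x i) y"
          using distance_on_triangle[OF dist _ i(2)] by blast
        also have "\<dots> \<le> h + h" using i(1)[OF z] i(4) by (intro add_mono) auto
        finally show ?thesis using h(2) by auto
      qed
      then have "(SUP z\<in>A. d z y) \<le> t" by (rule SUP_least)
      with i(3) show "(INF y\<in>Z. SUP z\<in>A. d z y) \<le> t" by (rule INF_lower2)
    qed
  qed
  moreover have "Z \<subseteq> X" unfolding Z_def by blast
  ultimately obtain s where "dist_supremum X d Z s"
    using C unfolding dist_directed_complete_def by blast
  from limitin_dist_supremum[OF this \<open>Z \<subseteq> X\<close> _ near] show ?thesis unfolding Z_def by blast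
qed

text \<open>The zeros of \<open>d(\<cdot>, y)\<close> are the points below \<open>y\<close>, and
  these functions for all \<open>y\<close> in \<open>X\<close> form one family with a common
  \<delta>.\<close>

lemma exact_below_nearby:
  assumes r: "0 < r"
  shows "\<exists>\<delta>>0. \<forall>z\<in>X. \<forall>y\<in>X. d z y < \<delta> \<longrightarrow> (\<exists>w\<in>X. e z w < r \<and> d w y = 0)"
proof -
  let ?\<Phi> = "(\<lambda>y z. d z y) ` X"
  have "\<exists>\<delta>>0. \<forall>\<phi>\<in>?\<Phi>. \<forall>z\<in>X. \<phi> z < \<delta> \<longrightarrow> (\<forall>\<epsilon>>0. \<exists>z'\<in>X. e z z' < s \<and> \<phi> z' < \<epsilon>)"
    if s: "0 < s" for s
  proof -
    obtain q where q: "0 < q"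
      "\<And>x y \<epsilon>. x \<in> X \<Longrightarrow> y \<in> X \<Longrightarrow> d x y \<le> q \<Longrightarrow> 0 < \<epsilon> \<Longrightarrow> \<exists>z\<in>X. d z y < \<epsilon> \<and> e x z < s"
      using comp_Phi_small[OF s] by blast
    have "\<exists>z'\<in>X. e z z' < s \<and> \<phi> z' < \<epsilon>"
      if \<phi>: "\<phi> \<in> ?\<Phi>" and z: "z \<in> X" "\<phi> z < q" "0 < \<epsilon>" for \<phi> z \<epsilon>
    proof -
      from \<phi> obtain y where y: "y \<in> X" "\<phi> = (\<lambda>z. d z y)" by blast
      with z(2) have "d z y \<le> q" by simp
      from q(2)[OF z(1) y(1) this z(3)] y(2) show ?thesis by blast
    qed
    with q(1) show ?thesis by blast
  qed
  moreover have "\<phi> z \<le> d z w + \<phi> w" if "\<phi> \<in> ?\<Phi>" "z \<in> X" "w \<in> X" for \<phi> z w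
    using that distance_on_triangle[OF dist_d] by auto
  ultimately have "\<exists>\<delta>>0. \<forall>\<phi>\<in>?\<Phi>. \<forall>z\<in>X. \<phi> z < \<delta> \<longrightarrow> (\<exists>w\<in>X. e z w < r \<and> \<phi> w = 0)"
    using exact_zero_nearby[of ?\<Phi>, OF _ _ r] by blast
  then show ?thesis unfolding ball_simps by blast
qed

section \<open>Condition (4): from directed sets to increasing sequences\<close>

lemma countable_dense_subset:
  assumes "dist_separable X e" "Y \<subseteq> X"
  shows "\<exists>D\<subseteq>Y. countable D \<and> (\<forall>y\<in>Y. \<forall>t>0. \<exists>z\<in>D. e y z < t)"
proof -
  from assms(1) obtain D where D: "D \<subseteq> X" "countable D" "\<And>x. x \<in> X \<Longrightarrow> (INF y\<in>D. e x y) = 0"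
    unfolding dist_separable_def by blast
  obtain b :: "nat \<Rightarrow> ennreal"
    where b: "\<And>n. 0 < b n" "b \<longlonglongrightarrow> 0"
      by (rule ennreal_halving_sequence[OF zero_less_one]) blast
  \<comment> \<open>A dense point \<open>c\<close> need not lie in \<open>Y\<close>, so it is
    replaced by a point of \<open>Y\<close> within \<open>b n\<close> of it; pairs
    \<open>(c, n)\<close> without such a point are left out of \<open>?D\<close>.\<close>
  define f where "f c n = (SOME y. y \<in> Y \<and> e y c < b n)" for c n
  have f: "f c n \<in> Y" "e (f c n) c < b n" if "\<exists>y\<in>Y. e y c < b n" for c n
    using someI_ex[of "\<lambda>y. y \<in> Y \<and> e y c < b n"] that unfolding f_def by blast+
  let ?D = "(\<lambda>(c, n). f c n) ` {(c, n) \<in> D \<times> UNIV. \<exists>y\<in>Y. e y c < b n}"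
  have "countable ?D"
    using D(2) by (intro countable_image countable_subset[OF _ countable_SIGMA[of D "\<lambda>_. UNIV"]]) auto
  moreover have "?D \<subseteq> Y" using f(1) by auto
  moreover have "\<exists>z\<in>?D. e y z < t" if y: "y \<in> Y" and t: "0 < t" for y t
  proof -
    from t obtain h where h: "0 < h" "h + h < t" by (rule ennreal_half)
    from b(2) h(1) have "eventually (\<lambda>n. b n < h) sequentially"
      by (simp add: order_tendsto_iff)
    then obtain n where n: "b n < h" by (auto simp: eventually_sequentially)
    have yX: "y \<in> X" using y assms(2) by blast
    from D(3)[OF this] b(1)[of n] obtain c where c: "c \<in> D" "e y c < b n"
      by (metis INF_less_iff)
    with y have *: "\<exists>y\<in>Y. e y c < b n" by blast
    have X: "c \<in> X" "f c n \<in> X" using f(1)[OF *] assms(2) c(1) D(1) by auto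
    have "e y (f c n) \<le> e y c + e (f c n) c"
      using distance_on_triangle[OF dist_e yX X] sym[OF X] by simp
    also have "\<dots> \<le> h + h" using c(2) f(2)[OF *] n by (intro add_mono) auto
    finally have "e y (f c n) < t" using h(2) by auto
    with * c(1) show ?thesis by (intro bexI[of _ "f c n"]) auto
  qed
  ultimately show ?thesis by (intro exI[of _ ?D] conjI ballI allI impI)
qed

text \<open>Values beyond \<open>k\<close> are unconstrained, so a chain is lengthened by a function
  update.\<close>

definition chain :: "nat \<Rightarrow> (nat \<Rightarrow> 'a) \<Rightarrow> bool" where
  "chain k v \<longleftrightarrow> (\<forall>i\<le>k. v i \<in> X) \<and> (\<forall>i<k. d (v i) (v (Suc i)) = 0)"

text \<open>The index is strict because \<open>d x x = 0\<close> is not assumed.\<close>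

lemma chain_d_last:
  assumes "chain k v" "i < k"
  shows "d (v i) (v k) = 0"
  using assms
proof (induction k)
  case (Suc k)
  show ?case
  proof (cases "i = k")
    case True
    with Suc.prems show ?thesis by (auto simp: chain_def)
  next
    case False
    with Suc have "d (v i) (v k) = 0" "d (v k) (v (Suc k)) = 0" by (auto simp: chain_def)
    moreover have "d (v i) (v (Suc k)) \<le> d (v i) (v k) + d (v k) (v (Suc k))"
      using Suc.prems by (intro distance_on_triangle[OF dist_d]) (auto simp: chain_def)
    ultimately show ?thesis by simp
  qed
qed simp

text \<open>The last entry is corrected first, to a point \<open>w\<close> exactly below
  \<open>u\<close>. If this moves it little enough, the previous entry is still
  \<open>d\<close>-close below \<open>w\<close>, and the induction hypothesis applies with
  \<open>w\<close> in place of \<open>u\<close>.\<close>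

lemma chain_below:
  assumes "0 < r"
  shows "\<exists>\<rho>>0. \<forall>v u. chain k v \<and> u \<in> X \<and> d (v k) u < \<rho> \<longrightarrow>
    (\<exists>v'. chain k v' \<and> (\<forall>i\<le>k. e (v i) (v' i) < r) \<and> d (v' k) u = 0)"
proof (induction k)
  case 0
  obtain \<delta> where \<delta>: "0 < \<delta>"
    "\<And>z y. z \<in> X \<Longrightarrow> y \<in> X \<Longrightarrow> d z y < \<delta> \<Longrightarrow> \<exists>w\<in>X. e z w < r \<and> d w y = 0"
      using exact_below_nearby[OF assms] by blast
  have "\<exists>v'. chain 0 v' \<and> (\<forall>i\<le>0. e (v i) (v' i) < r) \<and> d (v' 0) u = 0"
    if "chain 0 v \<and> u \<in> X \<and> d (v 0) u < \<delta>" for v u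
  proof -
    from that \<delta>(2)[of "v 0" u] obtain w where "w \<in> X" "e (v 0) w < r" "d w u = 0"
      by (auto simp: chain_def)
    then show ?thesis by (intro exI[of _ "\<lambda>_. w"]) (auto simp: chain_def)
  qed
  with \<delta>(1) show ?case by blast
next
  case (Suc k)
  then obtain \<rho> where \<rho>: "0 < \<rho>" "\<And>v u. chain k v \<Longrightarrow> u \<in> X \<Longrightarrow> d (v k) u < \<rho> \<Longrightarrow>
    \<exists>v'. chain k v' \<and> (\<forall>i\<le>k. e (v i) (v' i) < r) \<and> d (v' k) u = 0"
      by blast
  obtain q where q: "0 < q"
    "\<And>x y. x \<in> X \<Longrightarrow> y \<in> X \<Longrightarrow> e x y \<le> q \<Longrightarrow> d x y < \<rho> \<and> d y x < \<rho>"
      using d_small[OF \<rho>(1)] by blast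
  \<comment> \<open>\<open>q\<close> keeps the entry before the last within \<open>\<rho>\<close> of
    \<open>w\<close>; \<open>r\<close> is the accuracy required in the end.\<close>
  from q(1) assms have qr: "0 < min q r" by simp
  obtain \<delta> where \<delta>: "0 < \<delta>"
    "\<And>z y. z \<in> X \<Longrightarrow> y \<in> X \<Longrightarrow> d z y < \<delta> \<Longrightarrow> \<exists>w\<in>X. e z w < min q r \<and> d w y = 0"
      using exact_below_nearby[OF qr] by blast
  have "\<exists>v'. chain (Suc k) v' \<and> (\<forall>i\<le>Suc k. e (v i) (v' i) < r) \<and> d (v' (Suc k)) u = 0"
    if v: "chain (Suc k) v \<and> u \<in> X \<and> d (v (Suc k)) u < \<delta>" for v u
  proof -
    from v have vX: "v k \<in> X" "v (Suc k) \<in> X" "d (v k) (v (Suc k)) = 0" "chain k v"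
      by (auto simp: chain_def)
    from \<delta>(2)[OF vX(2), of u] v
    obtain w where w: "w \<in> X" "e (v (Suc k)) w < min q r" "d w u = 0" by blast
    have "d (v k) w \<le> d (v k) (v (Suc k)) + d (v (Suc k)) w"
      by (rule distance_on_triangle[OF dist_d vX(1,2) w(1)])
    also have "\<dots> < \<rho>" using q(2)[OF vX(2) w(1)] vX(3) w(2) by (simp add: less_imp_le)
    finally obtain v' where v': "chain k v'" "\<And>i. i \<le> k \<Longrightarrow> e (v i) (v' i) < r" "d (v' k) w = 0"
      using \<rho>(2)[OF vX(4) w(1)] by blast
    then show ?thesis
      using w by (intro exI[of _ "v'(Suc k := w)"]) (auto simp: chain_def less_Suc_eq le_Suc_eq)
  qed
  with \<delta>(1) show ?case by blast
qed

lemma dist_directed_near: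
  assumes "dist_directed d Y" "finite A" "A \<subseteq> Y" "0 < t"
  shows "\<exists>u\<in>Y. \<forall>z\<in>A. d z u < t"
proof -
  have "(INF y\<in>Y. SUP z\<in>A. d z y) < t"
    using assms unfolding dist_directed_def by simp
  then obtain u where "u \<in> Y" "(SUP z\<in>A. d z u) < t" unfolding INF_less_iff by blast
  then show ?thesis by (intro bexI[of _ u] ballI) (auto dest: SUP_lessD)
qed

text \<open>The supremum of an increasing sequence \<open>w\<close> also serves \<open>Y\<close>:
  each \<open>w i\<close> is approximated by points below elements of \<open>Y\<close>, and each
  element of a dense sequence in \<open>Y\<close> lies approximately below some
  \<open>w k\<close>.\<close>

lemma directed_complete_if_separable:
  assumes C: "dist_le_directed_complete X d" and sep: "dist_separable X e"
  shows "dist_directed_complete X d"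
  unfolding dist_directed_complete_def
proof (intro allI impI, elim conjE)
  fix Y assume YX: "Y \<subseteq> X" and Y: "dist_directed d Y"
  obtain D
    where D: "D \<subseteq> Y" "countable D" "\<And>y t. y \<in> Y \<Longrightarrow> 0 < t \<Longrightarrow> \<exists>z\<in>D. e y z < t"
      using countable_dense_subset[OF sep YX] by blast
  \<comment> \<open>Directedness for the empty set forces \<open>Y\<close> to be nonempty, as the
    empty infimum is \<open>top\<close>.\<close>
  from dist_directed_near[OF Y, of "{}" 1] obtain y0 where y0: "y0 \<in> Y" by auto
  with D(3)[OF y0, of 1] have "D \<noteq> {}" by auto
  define g where "g = from_nat_into D"
  have g: "range g = D" unfolding g_def using D(2) \<open>D \<noteq> {}\<close> by (rule range_from_nat_into[rotated])
  then have gY: "g i \<in> Y" for i using D(1) by auto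
  obtain b :: "nat \<Rightarrow> ennreal"
    where b: "\<And>n. 0 < b n" "\<And>n. b (Suc n) + b (Suc n) \<le> b n" "b \<longlonglongrightarrow> 0"
      by (rule ennreal_halving_sequence[OF zero_less_one]) blast
  \<comment> \<open>A chain in \<open>Y\<close> need not exist, so the \<open>k\<close>-th stage is a chain of length \<open>k + 1\<close> whose last
    element only lies in \<open>Y\<close>; adding a new last element moves the earlier ones slightly, and the
    sequence wanted consists of the \<open>e\<close>-limits of the entries.\<close>
  have "\<exists>V. \<forall>k. (chain k (V k) \<and> V k k \<in> Y) \<and> ((\<forall>i\<le>k. e (V k i) (V (Suc k) i) < b (Suc k)) \<and>
      (\<forall>i\<le>k. d (g i) (V (Suc k) (Suc k)) < b k))"
  proof (rule dependent_nat_choice)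
    show "\<exists>v. chain 0 v \<and> v 0 \<in> Y"
      using y0 YX by (intro exI[of _ "\<lambda>_. y0"]) (auto simp: chain_def)
    fix v k assume v: "chain k v \<and> v k \<in> Y"
    from chain_below[OF b(1), of k "Suc k"] obtain \<rho> where \<rho>: "0 < \<rho>"
      "\<And>v u. chain k v \<Longrightarrow> u \<in> X \<Longrightarrow> d (v k) u < \<rho> \<Longrightarrow>
        \<exists>v'. chain k v' \<and> (\<forall>i\<le>k. e (v i) (v' i) < b (Suc k)) \<and> d (v' k) u = 0"
          by blast
    \<comment> \<open>The new last element is close above the old one, so that the chain can be
      repaired, and close above \<open>g 0\<close> to \<open>g k\<close>, so that the sequence
      eventually dominates \<open>Y\<close>.\<close>
    have "\<exists>u\<in>Y. \<forall>z\<in>insert (v k) (g ` {..k}). d z u < min \<rho> (b k)"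
      using v gY \<rho>(1) b(1)[of k] by (intro dist_directed_near[OF Y]) auto
    then obtain u where u: "u \<in> Y" "d (v k) u < \<rho>" "\<And>i. i \<le> k \<Longrightarrow> d (g i) u < b k"
      by auto
    from u(1) YX have "u \<in> X" by blast
    from \<rho>(2)[of v u, OF _ this u(2)] v obtain v' where v': "chain k v'"
      "\<And>i. i \<le> k \<Longrightarrow> e (v i) (v' i) < b (Suc k)" "d (v' k) u = 0" by blast
    from u YX v' show "\<exists>v'. (chain (Suc k) v' \<and> v' (Suc k) \<in> Y) \<and>
        ((\<forall>i\<le>k. e (v i) (v' i) < b (Suc k)) \<and> (\<forall>i\<le>k. d (g i) (v' (Suc k)) < b k))"
      by (intro exI[of _ "v'(Suc k := u)"]) (auto simp: chain_def less_Suc_eq le_Suc_eq)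
  qed
  then obtain V where V: "\<And>k. chain k (V k)" "\<And>k. V k k \<in> Y"
    "\<And>i k. i \<le> k \<Longrightarrow> e (V k i) (V (Suc k) i) < b (Suc k)"
    "\<And>i k. i \<le> k \<Longrightarrow> d (g i) (V (Suc k) (Suc k)) < b k" by blast
  have VX: "V k i \<in> X" if "i \<le> k" for i k using V(1) that by (auto simp: chain_def)
  \<comment> \<open>The \<open>i\<close>-th entry is followed through the stages, starting at stage
    \<open>i\<close>, where it first belongs to the chain.\<close>
  have "\<exists>w\<in>X. \<forall>n. e (V (i + n) i) w \<le> b (i + n)" for i
  proof -
    have "e (V (i + n) i) (V (i + Suc n) i) \<le> b (i + Suc n)" for n
      using V(3)[of i "i + n"] by simp
    moreover have "(\<lambda>n. b (i + n)) \<longlonglongrightarrow> 0"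
      using LIMSEQ_ignore_initial_segment[OF b(3), of i] by (simp add: add.commute)
    ultimately obtain w where "w \<in> X" "\<And>n. e (V (i + n) i) w \<le> b (i + n)"
      using e_limit[of "\<lambda>n. V (i + n) i" "\<lambda>n. b (i + n)"] VX b(2) by auto
    then show ?thesis by blast
  qed
  then obtain w where w: "\<And>i. w i \<in> X" "\<And>i n. e (V (i + n) i) (w i) \<le> b (i + n)"
    by metis
  have Vw: "e (V k i) (w i) \<le> b k" if "i \<le> k" for i k
    using w(2)[of i "k - i"] that by simp
  have close: "\<exists>k0. \<forall>k\<ge>k0. b k < t \<and> (\<forall>i\<le>k. d (V k i) (w i) < t \<and> d (w i) (V k i) < t)"
    if t: "0 < t" for t
  proof -
    obtain q where q: "0 < q"
      "\<And>x y. x \<in> X \<Longrightarrow> y \<in> X \<Longrightarrow> e x y \<le> q \<Longrightarrow> d x y < t \<and> d y x < t"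
        using d_small[OF t] by blast
    from b(3) q(1) t have "eventually (\<lambda>k. b k < q \<and> b k < t) sequentially"
      by (simp add: order_tendsto_iff eventually_conj_iff)
    then obtain k0 where k0: "\<And>k. k0 \<le> k \<Longrightarrow> b k < q \<and> b k < t"
      unfolding eventually_sequentially by blast
    have "d (V k i) (w i) < t \<and> d (w i) (V k i) < t" if "k0 \<le> k" "i \<le> k" for k i
      using q(2)[OF VX w(1)] Vw k0 that by (meson less_imp_le order_trans)
    with k0 show ?thesis by blast
  qed
  \<comment> \<open>The exact inequality between neighbouring entries of stage \<open>k\<close>
    passes to the limits as \<open>k\<close> grows.\<close>
  have w_Suc: "d (w i) (w (Suc i)) = 0" for i
  proof (rule ennreal_eq_0_if_le_pos)
    fix t :: ennreal assume "0 < t"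
    then obtain h where h: "0 < h" "h + h < t" by (rule ennreal_half)
    from close[OF h(1)] obtain k0 where k0: "\<And>k i. k0 \<le> k \<Longrightarrow> i \<le> k \<Longrightarrow>
      d (V k i) (w i) < h \<and> d (w i) (V k i) < h" by blast
    define k where "k = max k0 (Suc i)"
    have k: "k0 \<le> k" "i \<le> k" "Suc i \<le> k" "i < k" unfolding k_def by auto
    have "d (w i) (w (Suc i)) \<le> d (w i) (V k i) + d (V k i) (w (Suc i))"
      by (rule distance_on_triangle[OF dist_d w(1) VX[OF k(2)] w(1)])
    also have "d (V k i) (w (Suc i)) \<le> d (V k i) (V k (Suc i)) + d (V k (Suc i)) (w (Suc i))"
      by (rule distance_on_triangle[OF dist_d VX[OF k(2)] VX[OF k(3)] w(1)])
    also have "d (V k i) (V k (Suc i)) = 0" using V(1)[of k] k(4) by (auto simp: chain_def)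
    also have "d (w i) (V k i) + (0 + d (V k (Suc i)) (w (Suc i))) \<le> h + (0 + h)"
      using k0[OF k(1,2)] k0[OF k(1,3)] by (intro add_mono) auto
    finally show "d (w i) (w (Suc i)) \<le> t" using h(2) by (simp add: add_left_mono)
  qed
  have "chain k w" for k using w(1) w_Suc by (auto simp: chain_def)
  from chain_d_last[OF this] have w_mono: "d (w i) (w k) = 0" if "i < k" for i k using that by blast
  have "dist_le_directed d (range w)"
    unfolding dist_le_directed_def
  proof (intro allI impI, elim conjE)
    fix A assume "finite A" "A \<subseteq> range w"
    then obtain I where I: "finite I" "A = w ` I" by (meson finite_subset_image)
    \<comment> \<open>The successor makes the index strictly larger, as \<open>w_mono\<close>
      demands; for empty \<open>I\<close> the value of \<open>Max I\<close> is irrelevant.\<close>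
    have "\<forall>z\<in>A. dist_le d z (w (Suc (Max I)))"
      using I Max_ge[OF I(1)] w_mono unfolding dist_le_def by (auto simp: le_imp_less_Suc)
    then show "\<exists>y\<in>range w. \<forall>z\<in>A. dist_le d z y" by blast
  qed
  with C w(1) obtain s where s: "dist_supremum X d (range w) s"
    unfolding dist_le_directed_complete_def by (meson image_subset_iff)
  then have sX: "s \<in> X" and ws: "\<And>i. d (w i) s = 0" and s_sup: "\<And>c. c \<in> X \<Longrightarrow> d s c = (SUP i. d (w i) c)"
    unfolding dist_supremum_def dist_le_def by (auto simp: image_image)
  \<comment> \<open>The path runs from \<open>g i\<close> to the last entry of stage
    \<open>Suc k\<close>, on to its limit \<open>w (Suc k)\<close>, and then to \<open>s\<close>;
    only the first two legs cost anything, and both shrink with \<open>k\<close>.\<close>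
  have gs: "d (g i) s = 0" for i
  proof (rule ennreal_eq_0_if_le_pos)
    fix t :: ennreal assume "0 < t"
    then obtain h where h: "0 < h" "h + h < t" by (rule ennreal_half)
    from close[OF h(1)] obtain k0 where k0: "\<And>k. k0 \<le> k \<Longrightarrow> b k < h"
      "\<And>k i. k0 \<le> k \<Longrightarrow> i \<le> k \<Longrightarrow> d (V k i) (w i) < h \<and> d (w i) (V k i) < h"
        by blast
    define k where "k = max k0 i"
    have k: "k0 \<le> k" "i \<le> k" "k0 \<le> Suc k" unfolding k_def by auto
    let ?v = "V (Suc k) (Suc k)"
    have vX: "?v \<in> X" and gX: "g i \<in> X" using VX gY YX by auto
    have "d (g i) s \<le> d (g i) ?v + d ?v s" by (rule distance_on_triangle[OF dist_d gX vX sX])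
    also have "d ?v s \<le> d ?v (w (Suc k)) + d (w (Suc k)) s"
      by (rule distance_on_triangle[OF dist_d vX w(1) sX])
    also have "d (w (Suc k)) s = 0" by (rule ws)
    also have "d (g i) ?v + (d ?v (w (Suc k)) + 0) \<le> h + (h + 0)"
      using V(4)[OF k(2)] k0(1)[OF k(1)] k0(2)[OF k(3) order_refl] by (intro add_mono) auto
    finally show "d (g i) s \<le> t" using h(2) by (simp add: add_left_mono)
  qed
  have Ys: "d y s = 0" if y: "y \<in> Y" for y
  proof (rule ennreal_eq_0_if_le_pos)
    fix t :: ennreal assume t: "0 < t"
    obtain q where q: "0 < q"
      "\<And>x y. x \<in> X \<Longrightarrow> y \<in> X \<Longrightarrow> e x y \<le> q \<Longrightarrow> d x y < t \<and> d y x < t"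
        using d_small[OF t] by blast
    from D(3)[OF y q(1)] g obtain i where i: "e y (g i) < q" by blast
    have X: "y \<in> X" "g i \<in> X" using y gY YX by auto
    have "d y s \<le> d y (g i) + d (g i) s" by (rule distance_on_triangle[OF dist_d X sX])
    also have "\<dots> \<le> t" using q(2)[OF X] i gs by (simp add: less_imp_le)
    finally show "d y s \<le> t" .
  qed
  have "d s c = (SUP y\<in>Y. d y c)" if c: "c \<in> X" for c
  proof (rule antisym)
    show "(SUP y\<in>Y. d y c) \<le> d s c"
    proof (rule SUP_least)
      fix y assume y: "y \<in> Y"
      with YX have "d y c \<le> d y s + d s c"
        by (intro distance_on_triangle[OF dist_d _ sX c]) auto
      with Ys[OF y] show "d y c \<le> d s c" by simp
    qed
    show "d s c \<le> (SUP y\<in>Y. d y c)"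
      unfolding s_sup[OF c]
    proof (rule SUP_least, rule ennreal_le_if_le_add_pos)
      fix i and t :: ennreal assume t: "0 < t"
      from close[OF t] obtain k0
        where k0: "\<forall>k\<ge>k0. b k < t \<and> (\<forall>i\<le>k. d (V k i) (w i) < t \<and> d (w i) (V k i) < t)" ..
      \<comment> \<open>Stage \<open>k\<close> must be strictly past \<open>i\<close> for
        \<open>V k i\<close> to lie below \<open>V k k\<close>, which belongs to
        \<open>Y\<close>.\<close>
      define k where "k = max k0 (Suc i)"
      have k: "k0 \<le> k" "i \<le> k" "i < k" unfolding k_def by auto
      have near: "d (w i) (V k i) < t" using k0 k(1,2) by blast
      have "d (w i) c \<le> d (w i) (V k i) + d (V k i) c"
        by (rule distance_on_triangle[OF dist_d w(1) VX[OF k(2)] c])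
      also have "d (V k i) c \<le> d (V k i) (V k k) + d (V k k) c"
        by (rule distance_on_triangle[OF dist_d VX[OF k(2)] VX[OF order_refl] c])
      also have "d (V k i) (V k k) = 0" by (rule chain_d_last[OF V(1) k(3)])
      also have "d (w i) (V k i) + (0 + d (V k k) c) \<le> t + (0 + (SUP y\<in>Y. d y c))"
        using near SUP_upper[OF V(2), of "\<lambda>y. d y c"] by (intro add_mono) auto
      finally show "d (w i) c \<le> t + (SUP y\<in>Y. d y c)" by (simp add: add_left_mono)
    qed
  qed
  with sX Ys have "dist_supremum X d Y s" unfolding dist_supremum_def dist_le_def by blast
  then show "\<exists>s. dist_supremum X d Y s" ..
qed

end

section \<open>From nets to filters, and the four conditions together\<close>

lemma cauchy_family_net:
  assumes d: "distance_on X d" and N: "net_index \<Lambda> R" and x: "\<forall>\<kappa>\<in>\<Lambda>. x \<kappa> \<in> X"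
    and C: "net_cauchy d \<Lambda> R x"
  shows "cauchy_family X d (net_filter \<Lambda> R) x"
proof
  show "net_filter \<Lambda> R \<noteq> bot"
    using N unfolding trivial_limit_def eventually_net_filter[OF N] by (auto simp: net_index_def)
  show "eventually (\<lambda>i. x i \<in> X) (net_filter \<Lambda> R)"
    using N x unfolding eventually_net_filter[OF N] by (auto simp: net_index_def)
  fix t :: ennreal assume "0 < t"
  \<comment> \<open>The index \<open>i\<close> itself serves as the threshold for
    \<open>j\<close>.\<close>
  with C show "eventually (\<lambda>i. eventually (\<lambda>j. d (x i) (x j) < t) (net_filter \<Lambda> R)) (net_filter \<Lambda> R)"
    unfolding eventually_net_filter[OF N] net_cauchy_def by meson
qed (rule d)

theorem corollary3:
  fixes X :: "'a set" and d e :: "'a \<Rightarrow> 'a \<Rightarrow> ennreal"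
  assumes "distance_on X d" and "distance_on X e"
    and "(dist_le_directed_complete X d \<and> precapprox UNIV (d_bullet X d) id)
       \<or> (dist_le_directed_complete X d \<and> dist_complete TYPE(('a \<times> nat) set) X (dist_sym d)
            \<and> (\<forall>r. d_fin X d r \<le> r))
       \<or> (dist_directed_complete X d \<and> dist_complete TYPE(('a \<times> nat) set) X e
            \<and> dist_precapprox X (comp_Phi X e d) d \<and> dist_precapprox X d e
            \<and> (\<forall>x\<in>X. \<forall>y\<in>X. e x y = dist_op e x y))
       \<or> (dist_le_directed_complete X d \<and> dist_complete TYPE(('a \<times> nat) set) X e
            \<and> dist_separable X e
            \<and> dist_precapprox X (comp_Phi X e d) d \<and> dist_precapprox X d e
            \<and> (\<forall>x\<in>X. \<forall>y\<in>X. e x y = dist_op e x y))"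
  shows "dist_complete TYPE('i) X d"
  unfolding dist_complete_def
proof (intro allI impI, elim conjE)
  fix \<Lambda> :: "'i set" and R and x :: "'i \<Rightarrow> 'a"
  assume "net_index \<Lambda> R" "\<forall>\<kappa>\<in>\<Lambda>. x \<kappa> \<in> X" "net_cauchy d \<Lambda> R x"
  with assms(1) have F: "cauchy_family X d (net_filter \<Lambda> R) x" by (intro cauchy_family_net)
  then interpret cauchy_family X d "net_filter \<Lambda> R" x .
  have refinement: "metric_refinement X d e"
    if "dist_complete TYPE(('a \<times> nat) set) X e" "dist_precapprox X (comp_Phi X e d) d"
      "dist_precapprox X d e" "\<forall>x\<in>X. \<forall>y\<in>X. e x y = dist_op e x y"
    by (rule metric_refinement.intro[OF assms(1,2) dist_complete_any_index[OF assms(2) that(1)]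
          that(2,3)]) (use that(4) in \<open>simp add: dist_op_def\<close>)
  from assms(3) show "\<exists>l. limitin (hole_topology X d) x l (net_filter \<Lambda> R)"
  proof (elim disjE conjE)
    assume "dist_le_directed_complete X d" "precapprox UNIV (d_bullet X d) id"
    then show ?thesis by (rule limit_if_d_bullet)
  next
    assume "dist_le_directed_complete X d" "dist_complete TYPE(('a \<times> nat) set) X (dist_sym d)"
      "\<forall>r. d_fin X d r \<le> r"
    then show ?thesis
      using dist_complete_any_index[OF distance_on_dist_sym[OF dist]] by (intro limit_if_d_fin) auto
  next
    assume "dist_directed_complete X d" "dist_complete TYPE(('a \<times> nat) set) X e"
      "dist_precapprox X (comp_Phi X e d) d" "dist_precapprox X d e"
      "\<forall>x\<in>X. \<forall>y\<in>X. e x y = dist_op e x y"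
    then show ?thesis
      using metric_refinement.limit_if_directed_complete[OF refinement _ F] by blast
  next
    assume H: "dist_complete TYPE(('a \<times> nat) set) X e" "dist_precapprox X (comp_Phi X e d) d"
      "dist_precapprox X d e" "\<forall>x\<in>X. \<forall>y\<in>X. e x y = dist_op e x y"
      and "dist_le_directed_complete X d" "dist_separable X e"
    then have "dist_directed_complete X d"
      using metric_refinement.directed_complete_if_separable[OF refinement] by blast
    then show ?thesis
      by (rule metric_refinement.limit_if_directed_complete[OF refinement[OF H] _ F])
  qed
qed

end
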